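(* There exists a universal constant $C>0$ such that the following holds. Let $P=P_X\times P_{Y|X}$ and $Q=Q_X\times P_{Y|X}$ be probability distributions on $\mathcal X\times\mathcal Y$, let $1\le m<n$, let $Z_1,\dots,Z_n$ be i.i.d. from $P$, let $\mathbf D_n=(Z_1,\dots,Z_n)$, and let $Z_{\text{test}}=(X_{\text{test}},Y_{\text{test}})\sim Q$ be independent of $\mathbf D_n$. Let $\alpha\in(0,1)$ and let $\hat C^{\text{split}}_\alpha$ be the weighted split conformal prediction set built with an arbitrary training algorithm from the first $n-m$ points and calibrated on the last $m$ points. Assume that $Q\ll P$ and $dQ/dP\le B<\infty$. Let $$P_e^{\text{split}}(\mathbf D_n)=\mathbb P\left(Y_{\text{test}}\notin\hat C^{\text{split}}_\alpha(X_{\text{test}})\,\middle|\,\mathbf D_n\right).$$ Then for all $0<\delta\le 4$, $$\mathbb P\left(P_e^{\text{split}}(\mathbf D_n)>\alpha+\left(\sqrt{2B\log(4/\delta)}+2C\right)\sqrt{\frac{B}{m}}\right)\le\delta .$$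
   Context: Covariate shift: $P$ and $Q$ share the conditional law $P_{Y|X}$, so $dQ/dP(x,y)=dQ_X/dP_X(x)$ is a function of $x$ only; it is assumed known. Weighted split conformal set: $\hat\mu=T(Z_1,\dots,Z_{n-m})$ is a predictor function $\mathcal X\to\mathcal Y$ returned by an arbitrary (measurable) training algorithm $T$. The score is $s(x,y)=s(x,y;\hat\mu)=f(\hat\mu(x),y)$ for an arbitrary measurable $f:\mathcal Y\times\mathcal Y\to\mathbb R$. Let $\mathcal I=\{n-m+1,\dots,n\}$ be the calibration indices. For a test covariate $x$ set $$w_i=\frac{\frac{dQ}{dP}(Z_i)}{\frac{dQ_X}{dP_X}(x)+\sum_{j\in\mathcal I}\frac{dQ}{dP}(Z_j)}\ (i\in\mathcal I),\qquad w_{\text{test}}=\frac{\frac{dQ_X}{dP_X}(x)}{\frac{dQ_X}{dP_X}(x)+\sum_{j\in\mathcal I}\frac{dQ}{dP}(Z_j)},$$ $$F_{Q,m}(t)=w_{\text{test}}\mathbf 1\{t=\infty\}+\sum_{i\in\mathcal I}w_i\mathbf 1\{s(Z_i)\le t\},\qquad F_{Q,m}^{-1}(u)=\inf\{t\in[-\infty,\infty]:F_{Q,m}(t)\ge u\}.$$ Then $\hat C^{\text{split}}_\alpha(x)=\{y\in\mathcal Y: s(x,y)\le F_{Q,m}^{-1}(1-\alpha)\}$. The outer probability is over $\mathbf D_n\sim P^n$. *)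

theory Defs
  imports "HOL-Probability.Probability"
begin

text \<open>A conditional law of \<open>Y\<close> given \<open>X\<close> is a Markov kernel \<open>K \<in> MX \<rightarrow>\<^sub>M prob_algebra MY\<close>;
  \<open>joint_law MX MY PX K\<close> is the law of \<open>(X, Y)\<close> for \<open>X \<sim> PX\<close> and \<open>Y | X = x \<sim> K x\<close>.
  Covariate shift means that \<open>P\<close> and \<open>Q\<close> arise in this way from the same kernel \<open>K\<close>.\<close>

definition joint_law ::
    "'x measure \<Rightarrow> 'y measure \<Rightarrow> 'x measure \<Rightarrow> ('x \<Rightarrow> 'y measure) \<Rightarrow> ('x \<times> 'y) measure" where
  "joint_law MX MY PX K = PX \<bind> (\<lambda>x. distr (K x) (MX \<Otimes>\<^sub>M MY) (Pair x))"

lemma emeasure_joint_law: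
  assumes PX: "PX \<in> space (prob_algebra MX)" and K: "K \<in> MX \<rightarrow>\<^sub>M prob_algebra MY"
    and A: "A \<in> sets (MX \<Otimes>\<^sub>M MY)"
  shows "emeasure (joint_law MX MY PX K) A = (\<integral>\<^sup>+x. emeasure (K x) (Pair x -` A) \<partial>PX)"
proof -
  have sp: "sets PX = sets MX" "space PX = space MX"
    using PX by (auto simp: space_prob_algebra dest: sets_eq_imp_space_eq)
  have kern: "(\<lambda>x. distr (K x) (MX \<Otimes>\<^sub>M MY) (Pair x)) \<in> PX \<rightarrow>\<^sub>M prob_algebra (MX \<Otimes>\<^sub>M MY)"
    unfolding measurable_cong_sets[OF sp(1) refl]
    by (rule measurable_distr_prob_space2[OF K]) simp
  have "emeasure (joint_law MX MY PX K) A
      = (\<integral>\<^sup>+x. emeasure (distr (K x) (MX \<Otimes>\<^sub>M MY) (Pair x)) A \<partial>PX)"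
    unfolding joint_law_def using PX sp
    by (intro emeasure_bind_prob_algebra[OF _ kern A]) (simp add: space_prob_algebra)
  also have "\<dots> = (\<integral>\<^sup>+x. emeasure (K x) (Pair x -` A) \<partial>PX)"
  proof (rule nn_integral_cong)
    fix x assume "x \<in> space PX"
    then have x: "x \<in> space MX" using sp by simp
    then have Kx: "sets (K x) = sets MY"
      using measurable_space[OF K] by (auto simp: space_prob_algebra)
    have "Pair x \<in> K x \<rightarrow>\<^sub>M MX \<Otimes>\<^sub>M MY"
      using x by (simp add: measurable_cong_sets[OF Kx refl])
    moreover have "Pair x -` A \<inter> space (K x) = Pair x -` A"
      using sets.sets_into_space[OF A] sets_eq_imp_space_eq[OF Kx]
      by (auto simp: space_pair_measure)
    ultimately show "emeasure (distr (K x) (MX \<Otimes>\<^sub>M MY) (Pair x)) A = emeasure (K x) (Pair x -` A)"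
      using A by (simp add: emeasure_distr)
  qed
  finally show ?thesis .
qed

text \<open>The derivative \<open>dQ/dP\<close>. It is almost everywhere finite in the situations considered here,
  so the passage from \<^typ>\<open>ennreal\<close> to \<^typ>\<open>real\<close> changes it at most on a null set.\<close>

definition rn_density :: "'a measure \<Rightarrow> 'a measure \<Rightarrow> 'a \<Rightarrow> real" where
  "rn_density P Q z = enn2real (RN_deriv P Q z)"

definition score :: "('y \<Rightarrow> 'y \<Rightarrow> real) \<Rightarrow> ('x \<Rightarrow> 'y) \<Rightarrow> 'x \<times> 'y \<Rightarrow> real" where
  "score f mu z = f (mu (fst z)) (snd z)"

text \<open>In the definitions below \<open>r\<close> stands for \<open>dQ/dP\<close>, \<open>rX\<close> for \<open>dQ\<^sub>X/dP\<^sub>X\<close>, \<open>I\<close> for the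
  calibration indices, \<open>D\<close> for the data, \<open>x\<close> for the test covariate and \<open>s\<close> for the score.
  If all weights vanish, then \<open>0 / 0 = 0\<close> makes the cdf zero, its quantiles at positive levels
  are \<open>\<infinity>\<close>, and the prediction set is the whole of \<open>space MY\<close>.\<close>

definition total_weight ::
    "('x \<times> 'y \<Rightarrow> real) \<Rightarrow> ('x \<Rightarrow> real) \<Rightarrow> nat set \<Rightarrow> (nat \<Rightarrow> 'x \<times> 'y) \<Rightarrow> 'x \<Rightarrow> real" where
  "total_weight r rX I D x = rX x + (\<Sum>j\<in>I. r (D j))"

definition calib_weight ::
    "('x \<times> 'y \<Rightarrow> real) \<Rightarrow> ('x \<Rightarrow> real) \<Rightarrow> nat set \<Rightarrow> (nat \<Rightarrow> 'x \<times> 'y) \<Rightarrow> 'x \<Rightarrow> nat \<Rightarrow> real" where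
  "calib_weight r rX I D x i = r (D i) / total_weight r rX I D x"

definition test_weight ::
    "('x \<times> 'y \<Rightarrow> real) \<Rightarrow> ('x \<Rightarrow> real) \<Rightarrow> nat set \<Rightarrow> (nat \<Rightarrow> 'x \<times> 'y) \<Rightarrow> 'x \<Rightarrow> real" where
  "test_weight r rX I D x = rX x / total_weight r rX I D x"

definition weighted_cdf ::
    "('x \<times> 'y \<Rightarrow> real) \<Rightarrow> ('x \<Rightarrow> real) \<Rightarrow> ('x \<times> 'y \<Rightarrow> real) \<Rightarrow> nat set \<Rightarrow> (nat \<Rightarrow> 'x \<times> 'y) \<Rightarrow> 'x
      \<Rightarrow> ereal \<Rightarrow> real" where
  "weighted_cdf r rX s I D x t =
     test_weight r rX I D x * of_bool (t = \<infinity>)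
     + (\<Sum>i\<in>I. calib_weight r rX I D x i * of_bool (ereal (s (D i)) \<le> t))"

definition weighted_quantile ::
    "('x \<times> 'y \<Rightarrow> real) \<Rightarrow> ('x \<Rightarrow> real) \<Rightarrow> ('x \<times> 'y \<Rightarrow> real) \<Rightarrow> nat set \<Rightarrow> (nat \<Rightarrow> 'x \<times> 'y) \<Rightarrow> 'x
      \<Rightarrow> real \<Rightarrow> ereal" where
  "weighted_quantile r rX s I D x u = Inf {t. weighted_cdf r rX s I D x t \<ge> u}"

text \<open>A training algorithm \<open>T\<close> takes the first \<open>n - m\<close> data points (as an element of the
  product space over \<open>{1..n - m}\<close>) and returns a predictor.\<close>

definition split_conformal_set ::
    "'y measure \<Rightarrow> ('x \<times> 'y \<Rightarrow> real) \<Rightarrow> ('x \<Rightarrow> real) \<Rightarrow> ((nat \<Rightarrow> 'x \<times> 'y) \<Rightarrow> 'x \<Rightarrow> 'y)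
      \<Rightarrow> ('y \<Rightarrow> 'y \<Rightarrow> real) \<Rightarrow> nat \<Rightarrow> nat \<Rightarrow> real \<Rightarrow> (nat \<Rightarrow> 'x \<times> 'y) \<Rightarrow> 'x \<Rightarrow> 'y set" where
  "split_conformal_set MY r rX T f n m \<alpha> D x =
     (let s = score f (T (restrict D {1..n - m}))
      in {y \<in> space MY. ereal (s (x, y)) \<le> weighted_quantile r rX s {n - m + 1..n} D x (1 - \<alpha>)})"

definition sample :: "(nat \<Rightarrow> 'w \<Rightarrow> 'z) \<Rightarrow> nat \<Rightarrow> 'w \<Rightarrow> nat \<Rightarrow> 'z" where
  "sample Z n \<omega> = restrict (\<lambda>i. Z i \<omega>) {1..n}"

definition sample_algebra ::
    "'w measure \<Rightarrow> 'z measure \<Rightarrow> (nat \<Rightarrow> 'w \<Rightarrow> 'z) \<Rightarrow> nat \<Rightarrow> 'w measure" where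
  "sample_algebra M S Z n = vimage_algebra (space M) (sample Z n) (\<Pi>\<^sub>M i\<in>{1..n}. S)"

text \<open>The conditional probability of miscoverage given the sample, as a conditional expectation
  on the underlying probability space \<open>M\<close>.\<close>

definition split_miscoverage ::
    "'w measure \<Rightarrow> 'x measure \<Rightarrow> 'y measure \<Rightarrow> ('x \<times> 'y \<Rightarrow> real) \<Rightarrow> ('x \<Rightarrow> real)
      \<Rightarrow> ((nat \<Rightarrow> 'x \<times> 'y) \<Rightarrow> 'x \<Rightarrow> 'y) \<Rightarrow> ('y \<Rightarrow> 'y \<Rightarrow> real) \<Rightarrow> nat \<Rightarrow> nat \<Rightarrow> real
      \<Rightarrow> (nat \<Rightarrow> 'w \<Rightarrow> 'x \<times> 'y) \<Rightarrow> ('w \<Rightarrow> 'x \<times> 'y) \<Rightarrow> 'w \<Rightarrow> real" where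
  "split_miscoverage M MX MY r rX T f n m \<alpha> Z Ztest =
     real_cond_exp M (sample_algebra M (MX \<Otimes>\<^sub>M MY) Z n)
       (indicator {\<omega> \<in> space M.
          snd (Ztest \<omega>) \<notin> split_conformal_set MY r rX T f n m \<alpha> (sample Z n \<omega>) (fst (Ztest \<omega>))})"

text \<open>A universal constant must not depend on the carrier types of the spaces involved. Since HOL
  cannot quantify over types under an existential quantifier, an existentially quantified
  constant is in addition bounded by a fixed numeral. The claims in question are monotone in the
  constant, so that one value then serves for all types; the numeral itself has no significance.\<close>

end

theory Submission
  imports Defs
begin

text \<open>Write \<open>\<phi> t (z) = r z * (of_bool (t < s z) - \<alpha>)\<close> with \<open>r = dQ/dP\<close>, so that
  \<open>E\<^sub>P (\<phi> t) = Q (s > t) - \<alpha>\<close>. Since the test weight is nonnegative, a miscovered test point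
  has score above some rational \<open>t\<close> for which the calibration average of \<open>\<phi> t\<close> is at most zero.
  Hence the excess miscoverage is at most the supremum over \<open>t\<close> of the deviation of the calibration
  average of \<open>\<phi> t\<close> from its mean. McDiarmid's inequality with increments \<open>B / m\<close> (the range of
  \<open>\<phi> t\<close> has length \<open>B\<close>) concentrates this supremum. Its mean is at most \<open>4 * sqrt (B / m)\<close>:
  after symmetrization, the half-lines turn the supremum into the maximum of a Rademacher walk in the
  order of the scores, to which Doob's \<open>L\<^sup>2\<close> inequality and \<open>E\<^sub>P (r\<^sup>2) \<le> B\<close> apply.\<close>

subsection \<open>Rademacher walks\<close>

text \<open>The conformal weights are ratios with a random denominator. Multiplying the quantile
  condition by the total weight turns it into a condition on the sign of a plain sum of independent
  terms, to which concentration applies. The threshold selected by calibration depends on the same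
  points, so the deviation has to be controlled for all thresholds at once; rational ones suffice
  and keep the supremum measurable. The score is random as well, but only through the training
  points: Fubini freezes these, and the deviation is estimated for a fixed score under the product
  law of the calibration points. Random signs are encoded as subsets \<open>A\<close> of the index
  set, and a mean over signs as a sum over \<open>Pow I\<close> without normalising factor.
  Symmetrization and the maximal inequality thereby become inductions over a finite index
  set.\<close>

definition rsign :: "'i set \<Rightarrow> 'i \<Rightarrow> real" where
  "rsign A i = (if i \<in> A then 1 else - 1)"

text \<open>The power-set form of conditioning on one sign: \<open>A\<close> and
  \<open>insert i A\<close> carry the signs \<open>- 1\<close> and \<open>1\<close> at
  \<open>i\<close>.\<close>

lemma sum_Pow_insert_split:
  fixes F :: "'i set \<Rightarrow> real"
  assumes "finite I" "i \<notin> I"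
  shows "(\<Sum>A\<in>Pow (insert i I). F A) = (\<Sum>A\<in>Pow I. F A + F (insert i A))"
proof -
  have "inj_on (insert i) (Pow I)"
    using assms(2) by (auto simp: inj_on_def)
  moreover have "Pow I \<inter> insert i ` Pow I = {}"
    using assms(2) by auto
  ultimately show ?thesis
    using assms(1) unfolding Pow_insert
    by (subst sum.union_disjoint) (auto simp: sum.reindex sum.distrib)
qed

lemma sum_rsign_insert:
  assumes "finite I" "i \<notin> I" "A \<subseteq> I"
  shows "(\<Sum>j\<in>insert i I. rsign A j * a j) = (\<Sum>j\<in>I. rsign A j * a j) - a i"
    and "(\<Sum>j\<in>insert i I. rsign (insert i A) j * a j) = (\<Sum>j\<in>I. rsign A j * a j) + a i"
proof -
  have "(\<Sum>j\<in>I. rsign (insert i A) j * a j) = (\<Sum>j\<in>I. rsign A j * a j)"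
    using assms by (intro sum.cong) (auto simp: rsign_def)
  then show "(\<Sum>j\<in>insert i I. rsign A j * a j) = (\<Sum>j\<in>I. rsign A j * a j) - a i"
    and "(\<Sum>j\<in>insert i I. rsign (insert i A) j * a j) = (\<Sum>j\<in>I. rsign A j * a j) + a i"
    using assms by (auto simp: rsign_def)
qed

lemma sum_Pow_rsign_linear:
  assumes "finite I"
  shows "(\<Sum>A\<in>Pow I. \<Sum>i\<in>I. rsign A i * a i) = 0"
  using assms
proof (induction I)
  case (insert i I)
  have "(\<Sum>A\<in>Pow (insert i I). \<Sum>j\<in>insert i I. rsign A j * a j)
      = (\<Sum>A\<in>Pow I. 2 * (\<Sum>j\<in>I. rsign A j * a j))"
    unfolding sum_Pow_insert_split[OF insert(1,2)] using insert(1,2)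
    by (intro sum.cong refl) (simp add: sum_rsign_insert del: sum.insert)
  then show ?case
    using insert.IH by (simp flip: sum_distrib_left)
qed simp

text \<open>Signs are orthogonal: flipping the sign at \<open>i\<close> flips the cross term with
  \<open>a i\<close>, so only squares survive.\<close>

lemma sum_Pow_rsign_square:
  assumes "finite I"
  shows "(\<Sum>A\<in>Pow I. (\<Sum>i\<in>I. rsign A i * a i)\<^sup>2) = 2 ^ card I * (\<Sum>i\<in>I. (a i)\<^sup>2)"
  using assms
proof (induction I)
  case (insert i I)
  have "(\<Sum>A\<in>Pow (insert i I). (\<Sum>j\<in>insert i I. rsign A j * a j)\<^sup>2)
      = (\<Sum>A\<in>Pow I. 2 * (\<Sum>j\<in>I. rsign A j * a j)\<^sup>2 + 2 * (a i)\<^sup>2)"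
    unfolding sum_Pow_insert_split[OF insert(1,2)] using insert(1,2)
    by (intro sum.cong refl)
      (simp add: sum_rsign_insert power2_sum power2_diff del: sum.insert)
  also have "\<dots> = 2 * (2 ^ card I * (\<Sum>i\<in>I. (a i)\<^sup>2)) + 2 ^ card I * (2 * (a i)\<^sup>2)"
    using insert.IH insert(1) by (simp add: sum.distrib card_Pow flip: sum_distrib_left)
  finally show ?case
    using insert(1,2) by (simp add: algebra_simps)
qed simp

text \<open>Doob's maximal inequality in \<open>L\<^sup>2\<close> for the Rademacher walk that visits the indices in
  increasing order of \<open>s\<close>: with \<open>M\<close> the running maximum and \<open>S\<close> the current position,
  \<open>2 * M * S - M\<^sup>2\<close> is a submartingale.\<close>

lemma rademacher_running_max:
  fixes s a :: "'i \<Rightarrow> real"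
  assumes "finite I"
  shows "\<exists>M. (\<forall>A\<in>Pow I. 0 \<le> M A \<and> (\<forall>t. (\<Sum>i\<in>{i\<in>I. s i \<le> t}. rsign A i * a i) \<le> M A))
    \<and> 0 \<le> (\<Sum>A\<in>Pow I. 2 * M A * (\<Sum>i\<in>I. rsign A i * a i) - (M A)\<^sup>2)"
  using assms
\<comment> \<open>The new index always has the largest score so far. Hence a half-line either
  contains all of \<open>insert x I\<close> or misses \<open>x\<close>, so half-lines are initial
  segments of the walk.\<close>
proof (induction I rule: finite_ranking_induct[where f = s])
  case empty
  then show ?case by (intro exI[of _ "\<lambda>_. 0"]) simp
next
  case (insert x I)
  show ?case
  proof (cases "x \<in> I")
    case True
    then show ?thesis using insert.IH by (simp add: insert_absorb)
  next
    case x: False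
    let ?S = "\<lambda>A. \<Sum>i\<in>I. rsign A i * a i"
    let ?S' = "\<lambda>A. \<Sum>i\<in>insert x I. rsign A i * a i"
    obtain M where M0: "\<And>A. A \<subseteq> I \<Longrightarrow> 0 \<le> M A"
      and Mt: "\<And>A t. A \<subseteq> I \<Longrightarrow> (\<Sum>i\<in>{i\<in>I. s i \<le> t}. rsign A i * a i) \<le> M A"
      and Msum: "0 \<le> (\<Sum>A\<in>Pow I. 2 * M A * ?S A - (M A)\<^sup>2)"
      using insert.IH by (auto simp: Pow_iff)
    \<comment> \<open>The old maximum is known for subsets of \<open>I\<close>, so the sign of
      \<open>x\<close> is erased first. Inside a block of equal scores the maximum also runs over
      positions that no half-line produces; it only has to bound the half-line sums from
      above.\<close>
    define M' where "M' A = max (M (A - {x})) (?S' A)" for A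
    have restr: "(\<Sum>i\<in>J. rsign A i * a i) = (\<Sum>i\<in>J. rsign (A - {x}) i * a i)"
      if "J \<subseteq> I" for A J
      using that x by (intro sum.cong) (auto simp: rsign_def)
    have ub: "(\<Sum>i\<in>{i\<in>insert x I. s i \<le> t}. rsign A i * a i) \<le> M' A"
      if A: "A \<subseteq> insert x I" for A t
    proof (cases "s x \<le> t")
      case True
      then have "{i\<in>insert x I. s i \<le> t} = insert x I"
        using insert.hyps by force
      then show ?thesis by (simp add: M'_def)
    next
      case False
      then have eq: "{i\<in>insert x I. s i \<le> t} = {i\<in>I. s i \<le> t}"
        by auto
      have "A - {x} \<subseteq> I" using A by auto
      from Mt[OF this, of t] show ?thesis
        unfolding eq M'_def by (subst restr) auto
    qed
    \<comment> \<open>If the new position exceeds the old maximum, updating the maximum gains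
      exactly the square of the difference.\<close>
    have step: "2 * M (A - {x}) * ?S' A - (M (A - {x}))\<^sup>2 \<le> 2 * M' A * ?S' A - (M' A)\<^sup>2" for A
    proof (cases "?S' A \<le> M (A - {x})")
      case False
      then have "2 * M' A * ?S' A - (M' A)\<^sup>2 - (2 * M (A - {x}) * ?S' A - (M (A - {x}))\<^sup>2)
        = (?S' A - M (A - {x}))\<^sup>2"
        by (simp add: M'_def power2_eq_square algebra_simps)
      then show ?thesis
        using zero_le_power2[of "?S' A - M (A - {x})"] by linarith
    qed (simp add: M'_def)
    have "0 \<le> 2 * (\<Sum>A\<in>Pow I. 2 * M A * ?S A - (M A)\<^sup>2)"
      using Msum by simp
    \<comment> \<open>The two signs at \<open>x\<close> contribute \<open>a x\<close> and
      \<open>- a x\<close> with the same factor \<open>M\<close>, which does not see that sign, so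
      they cancel.\<close>
    also have "\<dots> = (\<Sum>A\<in>Pow (insert x I). 2 * M (A - {x}) * ?S' A - (M (A - {x}))\<^sup>2)"
      unfolding sum_Pow_insert_split[OF insert(1) x]
    proof (subst sum_distrib_left, intro sum.cong refl)
      fix A assume "A \<in> Pow I"
      then have A: "A \<subseteq> I" "A - {x} = A" "insert x A - {x} = A"
        using x by auto
      show "2 * (2 * M A * ?S A - (M A)\<^sup>2)
        = 2 * M (A - {x}) * ?S' A - (M (A - {x}))\<^sup>2
          + (2 * M (insert x A - {x}) * ?S' (insert x A) - (M (insert x A - {x}))\<^sup>2)"
        unfolding A(2,3) sum_rsign_insert[OF insert(1) x A(1)] by (simp add: algebra_simps)
    qed
    also have "\<dots> \<le> (\<Sum>A\<in>Pow (insert x I). 2 * M' A * ?S' A - (M' A)\<^sup>2)"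
      by (intro sum_mono step)
    finally have sum: "0 \<le> (\<Sum>A\<in>Pow (insert x I). 2 * M' A * ?S' A - (M' A)\<^sup>2)" .
    have nonneg: "0 \<le> M' A" if "A \<subseteq> insert x I" for A
      using M0[of "A - {x}"] that by (auto simp: M'_def le_max_iff_disj)
    show ?thesis
      by (intro exI[of _ M'] conjI ballI allI sum) (simp_all only: Pow_iff nonneg ub)
  qed
qed

text \<open>Estimating \<open>2 * M\<close> by \<open>M\<^sup>2 / c + c\<close> instead of by a
  square root keeps the bound affine in the sum of squares. It can then be integrated over the
  sample before \<open>c\<close> is chosen.\<close>

lemma rademacher_maximal:
  fixes s a :: "'i \<Rightarrow> real"
  assumes I: "finite I" and c: "c > 0"
  shows "\<exists>M. (\<forall>A\<in>Pow I. \<forall>t. (\<Sum>i\<in>{i\<in>I. s i \<le> t}. rsign A i * a i) \<le> M A)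
    \<and> (\<Sum>A\<in>Pow I. 2 * M A) \<le> 2 ^ card I * (4 * (\<Sum>i\<in>I. (a i)\<^sup>2) / c + c)"
proof -
  let ?S = "\<lambda>A. \<Sum>i\<in>I. rsign A i * a i"
  obtain M where Mt: "\<forall>A\<in>Pow I. \<forall>t. (\<Sum>i\<in>{i\<in>I. s i \<le> t}. rsign A i * a i) \<le> M A"
    and Msum: "0 \<le> (\<Sum>A\<in>Pow I. 2 * M A * ?S A - (M A)\<^sup>2)"
    using rademacher_running_max[OF I, where s = s and a = a] by fast
  \<comment> \<open>Expanding the square of \<open>M - 2 * S\<close> absorbs half of
    \<open>M\<^sup>2\<close>; this is the origin of Doob's constant 4.\<close>
  have sq: "2 * M A * ?S A - (M A)\<^sup>2 \<le> 2 * (?S A)\<^sup>2 - (M A)\<^sup>2 / 2" for A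
    using zero_le_power2[of "M A - 2 * ?S A"] by (simp add: power2_eq_square algebra_simps)
  have "0 \<le> (\<Sum>A\<in>Pow I. 2 * (?S A)\<^sup>2 - (M A)\<^sup>2 / 2)"
    by (rule order_trans[OF Msum], intro sum_mono sq)
  also have "\<dots> = 2 * (\<Sum>A\<in>Pow I. (?S A)\<^sup>2) - (\<Sum>A\<in>Pow I. (M A)\<^sup>2) / 2"
    by (simp add: sum_subtractf sum_distrib_left sum_divide_distrib)
  finally have M2: "(\<Sum>A\<in>Pow I. (M A)\<^sup>2) \<le> 4 * 2 ^ card I * (\<Sum>i\<in>I. (a i)\<^sup>2)"
    unfolding sum_Pow_rsign_square[OF I] by simp
  have "2 * M A \<le> (M A)\<^sup>2 / c + c" for A
    using zero_le_power2[of "M A - c"] c by (simp add: field_simps power2_eq_square)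
  then have "(\<Sum>A\<in>Pow I. 2 * M A) \<le> (\<Sum>A\<in>Pow I. (M A)\<^sup>2 / c + c)"
    by (intro sum_mono)
  also have "\<dots> = (\<Sum>A\<in>Pow I. (M A)\<^sup>2) / c + 2 ^ card I * c"
    using I by (simp add: sum.distrib card_Pow sum_divide_distrib)
  also have "\<dots> \<le> (4 * 2 ^ card I * (\<Sum>i\<in>I. (a i)\<^sup>2)) / c + 2 ^ card I * c"
    using M2 c by (intro add_right_mono divide_right_mono) auto
  finally show ?thesis
    using Mt by (intro exI[of _ M]) (simp add: algebra_simps)
qed

subsection \<open>Bounded differences\<close>

context prob_space
begin

lemma product_prob_space_const: "product_prob_space (\<lambda>_. M)"
  by unfold_locales

lemma prob_space_PiM_const: "prob_space (Pi\<^sub>M I (\<lambda>_. M))"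
  by (intro prob_space_PiM prob_space_axioms)

lemma PiM_upd_space:
  "\<lbrakk>x \<in> space (Pi\<^sub>M I (\<lambda>_. M)); y \<in> space M\<rbrakk> \<Longrightarrow> x(i := y) \<in> space (Pi\<^sub>M (insert i I) (\<lambda>_. M))"
  by (auto simp: space_PiM PiE_iff extensional_def)

lemma integrable_bounded:
  fixes f :: "'a \<Rightarrow> real"
  assumes "f \<in> borel_measurable M" "\<And>x. x \<in> space M \<Longrightarrow> \<bar>f x\<bar> \<le> K"
  shows "integrable M f"
  by (rule integrable_const_bound[of _ K]) (use assms in auto)

lemma abs_expectation_le:
  fixes f :: "'a \<Rightarrow> real"
  assumes "f \<in> borel_measurable M" "\<And>x. x \<in> space M \<Longrightarrow> \<bar>f x\<bar> \<le> K"
  shows "\<bar>expectation f\<bar> \<le> K"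
proof -
  have "\<bar>expectation f\<bar> \<le> expectation (\<lambda>x. \<bar>f x\<bar>)"
    by (rule integral_abs_bound)
  also have "\<dots> \<le> expectation (\<lambda>_. K)"
    using assms by (intro integral_mono integrable_abs integrable_bounded[of f K]) auto
  finally show ?thesis by (simp add: prob_space)
qed

text \<open>The new coordinate may be integrated innermost or outermost. Inductions over the index
  set condition on it and use the outer form; \<open>symmetrize\<close> needs the exchange of the
  two.\<close>

lemma
  fixes f :: "('i \<Rightarrow> 'a) \<Rightarrow> real"
  assumes I: "finite I" "i \<notin> I"
    and f[measurable]: "f \<in> borel_measurable (Pi\<^sub>M (insert i I) (\<lambda>_. M))"
    and K: "\<And>x. x \<in> space (Pi\<^sub>M (insert i I) (\<lambda>_. M)) \<Longrightarrow> \<bar>f x\<bar> \<le> K"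
  shows integral_PiM_insert:
      "(\<integral>x. f x \<partial>Pi\<^sub>M (insert i I) (\<lambda>_. M)) = (\<integral>x. (\<integral>y. f (x(i := y)) \<partial>M) \<partial>Pi\<^sub>M I (\<lambda>_. M))"
    and integral_PiM_insert_rev:
      "(\<integral>x. f x \<partial>Pi\<^sub>M (insert i I) (\<lambda>_. M)) = (\<integral>y. (\<integral>x. f (x(i := y)) \<partial>Pi\<^sub>M I (\<lambda>_. M)) \<partial>M)"
proof -
  interpret PI: product_prob_space "\<lambda>_::'i. M" by (rule product_prob_space_const)
  interpret J: prob_space "Pi\<^sub>M (insert i I) (\<lambda>_. M)" by (rule prob_space_PiM_const)
  interpret I: prob_space "Pi\<^sub>M I (\<lambda>_. M)" by (rule prob_space_PiM_const)
  interpret IM: pair_prob_space "Pi\<^sub>M I (\<lambda>_. M)" M ..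
  have "integrable (Pi\<^sub>M (insert i I) (\<lambda>_. M)) f"
    using f K by (rule J.integrable_bounded)
  then show 1: "(\<integral>x. f x \<partial>Pi\<^sub>M (insert i I) (\<lambda>_. M)) = (\<integral>x. (\<integral>y. f (x(i := y)) \<partial>M) \<partial>Pi\<^sub>M I (\<lambda>_. M))"
    using I by (intro PI.product_integral_insert)
  have "integrable (Pi\<^sub>M I (\<lambda>_. M) \<Otimes>\<^sub>M M) (\<lambda>(x, y). f (x(i := y)))"
    by (rule IM.P.integrable_bounded[of _ K])
      (auto simp: space_pair_measure intro!: K PiM_upd_space)
  from IM.Fubini_integral[OF this] 1
  show "(\<integral>x. f x \<partial>Pi\<^sub>M (insert i I) (\<lambda>_. M)) = (\<integral>y. (\<integral>x. f (x(i := y)) \<partial>Pi\<^sub>M I (\<lambda>_. M)) \<partial>M)"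
    by simp
qed

lemma
  fixes f :: "('i \<Rightarrow> 'a) \<Rightarrow> real"
  assumes f[measurable]: "f \<in> borel_measurable (Pi\<^sub>M (insert i I) (\<lambda>_. M))"
    and K: "\<And>x. x \<in> space (Pi\<^sub>M (insert i I) (\<lambda>_. M)) \<Longrightarrow> \<bar>f x\<bar> \<le> K"
  shows integrable_integral_section: "integrable (Pi\<^sub>M I (\<lambda>_. M)) (\<lambda>x. \<integral>y. f (x(i := y)) \<partial>M)"
    and integrable_integral_section_rev: "integrable M (\<lambda>y. \<integral>x. f (x(i := y)) \<partial>Pi\<^sub>M I (\<lambda>_. M))"
proof -
  interpret I: prob_space "Pi\<^sub>M I (\<lambda>_. M)" by (rule prob_space_PiM_const)
  have b: "\<bar>f (x(i := y))\<bar> \<le> K" if "x \<in> space (Pi\<^sub>M I (\<lambda>_. M))" "y \<in> space M" for x y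
    using that by (intro K PiM_upd_space)
  have mx: "(\<lambda>y. f (x(i := y))) \<in> borel_measurable M" if "x \<in> space (Pi\<^sub>M I (\<lambda>_. M))" for x
    using that by measurable
  have my: "(\<lambda>x. f (x(i := y))) \<in> borel_measurable (Pi\<^sub>M I (\<lambda>_. M))" if "y \<in> space M" for y
    using that by measurable
  show "integrable (Pi\<^sub>M I (\<lambda>_. M)) (\<lambda>x. \<integral>y. f (x(i := y)) \<partial>M)"
    by (rule I.integrable_bounded[of _ K], measurable) (intro abs_expectation_le mx b)
  show "integrable M (\<lambda>y. \<integral>x. f (x(i := y)) \<partial>Pi\<^sub>M I (\<lambda>_. M))"
    by (rule integrable_bounded[of _ K], measurable) (intro I.abs_expectation_le my b)
qed

text \<open>Condition on the inserted coordinate. The section mean \<open>h\<close> oscillates by at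
  most \<open>c\<close>, so Hoeffding's lemma controls its exponential moment, and the induction
  hypothesis controls each section around its own mean. Every coordinate costs a factor
  \<open>exp (l\<^sup>2 * c\<^sup>2 / 8)\<close>.\<close>

lemma mcdiarmid_mgf:
  fixes g :: "('i \<Rightarrow> 'a) \<Rightarrow> real"
  assumes I: "finite I" and l: "l > 0"
    and g: "g \<in> borel_measurable (Pi\<^sub>M I (\<lambda>_. M))"
    and K: "\<And>x. x \<in> space (Pi\<^sub>M I (\<lambda>_. M)) \<Longrightarrow> \<bar>g x\<bar> \<le> K"
    and c: "\<And>x i y. \<lbrakk>x \<in> space (Pi\<^sub>M I (\<lambda>_. M)); i \<in> I; y \<in> space M\<rbrakk> \<Longrightarrow> \<bar>g (x(i := y)) - g x\<bar> \<le> c"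
  shows "(\<integral>\<^sup>+x. ennreal (exp (l * (g x - (\<integral>x. g x \<partial>Pi\<^sub>M I (\<lambda>_. M))))) \<partial>Pi\<^sub>M I (\<lambda>_. M))
    \<le> ennreal (exp (real (card I) * (l\<^sup>2 * c\<^sup>2 / 8)))"
  using I g K c
proof (induction I arbitrary: g)
  case empty
  interpret PI: product_prob_space "\<lambda>_::'i. M" by (rule product_prob_space_const)
  \<comment> \<open>The empty product is a point mass, so \<open>g\<close> equals its mean.\<close>
  have "(\<integral>x. g x \<partial>Pi\<^sub>M {} (\<lambda>_. M)) = g (\<lambda>_. undefined)"
    by (simp add: PiM_empty lebesgue_integral_count_space_finite)
  then show ?case
    by (simp add: PI.nn_integral_empty)
next
  case (insert i I)
  interpret PI: product_prob_space "\<lambda>_::'i. M" by (rule product_prob_space_const)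
  interpret I: prob_space "Pi\<^sub>M I (\<lambda>_. M)" by (rule prob_space_PiM_const)
  let ?PI = "Pi\<^sub>M I (\<lambda>_. M)" and ?PJ = "Pi\<^sub>M (insert i I) (\<lambda>_. M)"
  note [measurable] = insert.prems(1)
  have K: "\<bar>g x\<bar> \<le> K" if "x \<in> space ?PJ" for x
    using insert.prems(2) that .
  define h where "h y = (\<integral>x. g (x(i := y)) \<partial>?PI)" for y
  have hm[measurable]: "h \<in> borel_measurable M"
    unfolding h_def by measurable
  have Eg: "(\<integral>x. g x \<partial>?PJ) = expectation h"
    unfolding h_def by (rule integral_PiM_insert_rev[OF insert.hyps(1,2) insert.prems(1) K])
  have gy: "(\<lambda>x. g (x(i := y))) \<in> borel_measurable ?PI" if "y \<in> space M" for y
    using that by measurable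
  have gyK: "\<bar>g (x(i := y))\<bar> \<le> K" if "x \<in> space ?PI" "y \<in> space M" for x y
    using that by (intro K PiM_upd_space)
  have gyint: "integrable ?PI (\<lambda>x. g (x(i := y)))" if "y \<in> space M" for y
    using gy[OF that] gyK[OF _ that] by (rule I.integrable_bounded)
  have hdiff: "h y \<le> h y' + c" if y: "y \<in> space M" "y' \<in> space M" for y y'
  proof -
    have "h y \<le> (\<integral>x. g (x(i := y')) + c \<partial>?PI)"
      unfolding h_def
    proof (intro integral_mono gyint y Bochner_Integration.integrable_add)
      fix x assume x: "x \<in> space ?PI"
      have "\<bar>g ((x(i := y'))(i := y)) - g (x(i := y'))\<bar> \<le> c"
        using x y by (intro insert.prems(3) PiM_upd_space) auto
      then show "g (x(i := y)) \<le> g (x(i := y')) + c" by simp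
    qed simp
    also have "\<dots> = h y' + c"
      unfolding h_def using gyint[OF y(2)] by (simp add: I.prob_space)
    finally show ?thesis .
  qed
  \<comment> \<open>\<open>c\<close> bounds the full oscillation, so the values of \<open>h\<close>
    lie in an interval of length \<open>c\<close> above the infimum; a symmetric interval about the
    mean would have length \<open>2 * c\<close>.\<close>
  define a where "a = (INF y\<in>space M. h y)"
  have hK: "\<bar>h y\<bar> \<le> K" if "y \<in> space M" for y
    unfolding h_def using gy[OF that] gyK[OF _ that] by (rule I.abs_expectation_le)
  have bdd: "bdd_below (h ` space M)"
    using hK by (intro bdd_belowI2[of _ "- K"]) (simp add: abs_le_iff minus_le_iff)
  have hi: "h y \<in> {a..a + c}" if y: "y \<in> space M" for y
  proof -
    have "h y - c \<le> a"
      unfolding a_def using hdiff[OF y] not_empty by (intro cINF_greatest) (auto simp: diff_le_eq)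
    moreover have "a \<le> h y"
      unfolding a_def using bdd y by (intro cINF_lower)
    ultimately show ?thesis by simp
  qed
  interpret h: interval_bounded_random_variable M h a "a + c"
    by unfold_locales (use hi in auto)
  have IH: "(\<integral>\<^sup>+x. ennreal (exp (l * (g (x(i := y)) - h y))) \<partial>?PI)
      \<le> ennreal (exp (real (card I) * (l\<^sup>2 * c\<^sup>2 / 8)))" if y: "y \<in> space M" for y
    unfolding h_def
  proof (rule insert.IH[OF gy[OF y] gyK[OF _ y]])
    fix x j z assume x: "x \<in> space ?PI" "j \<in> I" "z \<in> space M"
    have "(x(j := z))(i := y) = (x(i := y))(j := z)"
      using x insert.hyps by (intro fun_upd_twist) auto
    moreover have "\<bar>g ((x(i := y))(j := z)) - g (x(i := y))\<bar> \<le> c"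
      using x y by (intro insert.prems(3) PiM_upd_space) auto
    ultimately show "\<bar>g (x(j := z, i := y)) - g (x(i := y))\<bar> \<le> c"
      by (simp only:)
  qed
  have "(\<integral>\<^sup>+x. ennreal (exp (l * (g x - expectation h))) \<partial>?PJ)
      = (\<integral>\<^sup>+y. (\<integral>\<^sup>+x. ennreal (exp (l * (g (x(i := y)) - expectation h))) \<partial>?PI) \<partial>M)"
    using insert.hyps by (intro PI.product_nn_integral_insert_rev) auto
  also have "\<dots> = (\<integral>\<^sup>+y. (\<integral>\<^sup>+x. ennreal (exp (l * (g (x(i := y)) - h y))) \<partial>?PI)
      * ennreal (exp (l * (h y - expectation h))) \<partial>M)"
  proof (intro nn_integral_cong)
    fix y assume y: "y \<in> space M"
    note [measurable] = gy[OF y]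
    show "(\<integral>\<^sup>+x. ennreal (exp (l * (g (x(i := y)) - expectation h))) \<partial>?PI)
      = (\<integral>\<^sup>+x. ennreal (exp (l * (g (x(i := y)) - h y))) \<partial>?PI) * ennreal (exp (l * (h y - expectation h)))"
      by (subst nn_integral_multc[symmetric])
        (auto simp: algebra_simps simp flip: ennreal_mult exp_add intro!: nn_integral_cong)
  qed
  also have "\<dots> \<le> (\<integral>\<^sup>+y. ennreal (exp (real (card I) * (l\<^sup>2 * c\<^sup>2 / 8)))
      * ennreal (exp (l * (h y - expectation h))) \<partial>M)"
    by (intro nn_integral_mono mult_right_mono IH) auto
  also have "\<dots> = ennreal (exp (real (card I) * (l\<^sup>2 * c\<^sup>2 / 8)))
      * (\<integral>\<^sup>+y. ennreal (exp (l * (h y - expectation h))) \<partial>M)"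
    by (rule nn_integral_cmult) auto
  also have "\<dots> \<le> ennreal (exp (real (card I) * (l\<^sup>2 * c\<^sup>2 / 8))) * ennreal (exp (l\<^sup>2 * c\<^sup>2 / 8))"
    using h.Hoeffdings_lemma_nn_integral[OF l] by (intro mult_left_mono) auto
  also have "\<dots> = ennreal (exp (real (card (insert i I)) * (l\<^sup>2 * c\<^sup>2 / 8)))"
    using insert.hyps by (simp add: algebra_simps flip: ennreal_mult exp_add)
  finally show ?case unfolding Eg .
qed

lemma mcdiarmid_ineq:
  fixes g :: "('i \<Rightarrow> 'a) \<Rightarrow> real"
  assumes I: "finite I" "I \<noteq> {}" and u: "u > 0" and c0: "c > 0"
    and g[measurable]: "g \<in> borel_measurable (Pi\<^sub>M I (\<lambda>_. M))"
    and K: "\<And>x. x \<in> space (Pi\<^sub>M I (\<lambda>_. M)) \<Longrightarrow> \<bar>g x\<bar> \<le> K"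
    and c: "\<And>x i y. \<lbrakk>x \<in> space (Pi\<^sub>M I (\<lambda>_. M)); i \<in> I; y \<in> space M\<rbrakk> \<Longrightarrow> \<bar>g (x(i := y)) - g x\<bar> \<le> c"
  shows "emeasure (Pi\<^sub>M I (\<lambda>_. M)) {x \<in> space (Pi\<^sub>M I (\<lambda>_. M)). g x \<ge> (\<integral>x. g x \<partial>Pi\<^sub>M I (\<lambda>_. M)) + u}
    \<le> ennreal (exp (- 2 * u\<^sup>2 / (real (card I) * c\<^sup>2)))"
proof -
  let ?PI = "Pi\<^sub>M I (\<lambda>_. M)"
  \<comment> \<open>The minimiser of
    \<open>- l * u + card I * l\<^sup>2 * c\<^sup>2 / 8\<close>.\<close>
  define l where "l = 4 * u / (real (card I) * c\<^sup>2)"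
  have n: "real (card I) > 0" using I by (simp add: card_gt_0_iff)
  have l: "l > 0" using u c0 n by (simp add: l_def)
  define E where "E = (\<integral>x. g x \<partial>?PI)"
  have "emeasure ?PI {x \<in> space ?PI. g x - E \<ge> u}
      \<le> ennreal (exp (- l * u)) * (\<integral>\<^sup>+x. ennreal (exp (l * (g x - E))) * indicator (space ?PI) x \<partial>?PI)"
    using l by (intro Chernoff_ineq_nn_integral_ge) auto
  also have "\<dots> = ennreal (exp (- l * u)) * (\<integral>\<^sup>+x. ennreal (exp (l * (g x - E))) \<partial>?PI)"
    by (intro arg_cong2[of _ _ _ _ "(*)"] nn_integral_cong) auto
  also have "\<dots> \<le> ennreal (exp (- l * u)) * ennreal (exp (real (card I) * (l\<^sup>2 * c\<^sup>2 / 8)))"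
    unfolding E_def by (intro mult_left_mono mcdiarmid_mgf[OF I(1) l g K c]) auto
  also have "\<dots> = ennreal (exp (- l * u + real (card I) * (l\<^sup>2 * c\<^sup>2 / 8)))"
    by (simp flip: ennreal_mult exp_add)
  also have "- l * u + real (card I) * (l\<^sup>2 * c\<^sup>2 / 8) = - 2 * u\<^sup>2 / (real (card I) * c\<^sup>2)"
    using n c0 by (simp add: l_def field_simps power2_eq_square)
  finally show ?thesis by (simp add: E_def algebra_simps)
qed

end

subsection \<open>Symmetrization\<close>

lemma abs_cSUP_le:
  fixes f :: "'t \<Rightarrow> real"
  assumes "T \<noteq> {}" "\<And>t. t \<in> T \<Longrightarrow> \<bar>f t\<bar> \<le> K"
  shows "\<bar>SUP t\<in>T. f t\<bar> \<le> K"
proof -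
  obtain t where t: "t \<in> T" using assms(1) by auto
  have "bdd_above (f ` T)"
    using assms(2) by (intro bdd_aboveI2[of _ _ K]) (simp add: abs_le_iff)
  then have "f t \<le> (SUP t\<in>T. f t)"
    using t by (intro cSUP_upper)
  moreover have "(SUP t\<in>T. f t) \<le> K"
    using assms by (intro cSUP_least) (auto simp: abs_le_iff)
  ultimately show ?thesis
    using assms(2)[OF t] by (auto simp: abs_le_iff)
qed

lemma bdd_above_abs:
  fixes f :: "'t \<Rightarrow> real"
  assumes "\<And>t. t \<in> T \<Longrightarrow> \<bar>f t\<bar> \<le> K"
  shows "bdd_above (f ` T)"
  using assms by (intro bdd_aboveI2[of _ _ K]) (simp add: abs_le_iff)

lemma abs_sum_le_card:
  fixes f :: "'i \<Rightarrow> real"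
  assumes "\<And>i. i \<in> I \<Longrightarrow> \<bar>f i\<bar> \<le> K"
  shows "\<bar>\<Sum>i\<in>I. f i\<bar> \<le> real (card I) * K"
  using order_trans[OF sum_abs sum_bounded_above[of I "\<lambda>i. \<bar>f i\<bar>" K]] assms by simp

text \<open>Countability of \<open>T\<close> makes suprema over it measurable. The uniform bound is
  needed because \<open>SUP\<close> is taken in the reals, where an unbounded supremum is
  unspecified.\<close>

locale bounded_class = prob_space M for M :: "'a measure" +
  fixes T :: "'t set" and \<phi> :: "'t \<Rightarrow> 'a \<Rightarrow> real" and K :: real
  assumes T: "countable T" "T \<noteq> {}"
    and \<phi>_measurable[measurable]: "\<And>t. t \<in> T \<Longrightarrow> \<phi> t \<in> borel_measurable M"
    and \<phi>_bounded: "\<And>t z. \<lbrakk>t \<in> T; z \<in> space M\<rbrakk> \<Longrightarrow> \<bar>\<phi> t z\<bar> \<le> K"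
begin

lemma integrable_\<phi>: "t \<in> T \<Longrightarrow> integrable M (\<phi> t)"
  using \<phi>_measurable \<phi>_bounded by (rule integrable_bounded)

lemma abs_expectation_\<phi>: "t \<in> T \<Longrightarrow> \<bar>expectation (\<phi> t)\<bar> \<le> K"
  using \<phi>_measurable \<phi>_bounded by (rule abs_expectation_le)

lemma abs_deviation: "\<lbrakk>t \<in> T; z \<in> space M\<rbrakk> \<Longrightarrow> \<bar>expectation (\<phi> t) - \<phi> t z\<bar> \<le> 2 * K"
  using abs_expectation_\<phi>[of t] \<phi>_bounded[of t z] by linarith

lemma abs_two_rsign: "\<lbrakk>t \<in> T; z \<in> space M\<rbrakk> \<Longrightarrow> \<bar>2 * (rsign A i * \<phi> t z)\<bar> \<le> 2 * K"
  using \<phi>_bounded[of t z] by (auto simp: rsign_def abs_mult)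

text \<open>Both halves of \<open>a + E \<phi> - \<phi> = (a + 2 * E \<phi>) / 2 + (a - 2 * \<phi>) / 2\<close> have the form of a
  symmetrized term, after moving the supremum inside the expectation in the first one.\<close>

lemma symmetrize_step:
  assumes b: "\<And>t. t \<in> T \<Longrightarrow> \<bar>b t\<bar> \<le> L"
  shows "(\<integral>z. (SUP t\<in>T. b t + (expectation (\<phi> t) - \<phi> t z)) \<partial>M)
    \<le> ((\<integral>z. (SUP t\<in>T. b t + 2 * \<phi> t z) \<partial>M) + (\<integral>z. (SUP t\<in>T. b t - 2 * \<phi> t z) \<partial>M)) / 2"
proof -
  have bnd: "\<bar>b t + 2 * \<phi> t z\<bar> \<le> L + 2 * K" "\<bar>b t - 2 * \<phi> t z\<bar> \<le> L + 2 * K"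
    "\<bar>b t + (expectation (\<phi> t) - \<phi> t z)\<bar> \<le> L + 2 * K" if "t \<in> T" "z \<in> space M" for t z
    using b[OF that(1)] \<phi>_bounded[OF that] abs_expectation_\<phi>[OF that(1)] by linarith+
  have int: "integrable M (\<lambda>z. SUP t\<in>T. b t + 2 * \<phi> t z)"
    "integrable M (\<lambda>z. SUP t\<in>T. b t - 2 * \<phi> t z)"
    "integrable M (\<lambda>z. SUP t\<in>T. b t + (expectation (\<phi> t) - \<phi> t z))"
    using T by (intro integrable_bounded[of _ "L + 2 * K"] borel_measurable_cSUP
        bdd_above_abs[of _ _ "L + 2 * K"] abs_cSUP_le bnd; simp)+
  let ?U = "\<integral>z. (SUP t\<in>T. b t + 2 * \<phi> t z) \<partial>M"
  have U: "b t + 2 * expectation (\<phi> t) \<le> ?U" if t: "t \<in> T" for t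
  proof -
    have "b t + 2 * expectation (\<phi> t) = (\<integral>z. b t + 2 * \<phi> t z \<partial>M)"
      using integrable_\<phi>[OF t] by (simp add: prob_space)
    also have "\<dots> \<le> ?U"
      using t integrable_\<phi>[OF t] int(1)
      by (intro integral_mono cSUP_upper bdd_above_abs[of _ _ "L + 2 * K"] bnd) auto
    finally show ?thesis .
  qed
  have "(\<integral>z. (SUP t\<in>T. b t + (expectation (\<phi> t) - \<phi> t z)) \<partial>M)
      \<le> (\<integral>z. ?U / 2 + (SUP t\<in>T. b t - 2 * \<phi> t z) / 2 \<partial>M)"
  proof (intro integral_mono int Bochner_Integration.integrable_add integrable_divide)
    fix z assume z: "z \<in> space M"
    show "(SUP t\<in>T. b t + (expectation (\<phi> t) - \<phi> t z)) \<le> ?U / 2 + (SUP t\<in>T. b t - 2 * \<phi> t z) / 2"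
    proof (rule cSUP_least[OF T(2)])
      fix t assume t: "t \<in> T"
      have "b t - 2 * \<phi> t z \<le> (SUP t\<in>T. b t - 2 * \<phi> t z)"
        using t z by (intro cSUP_upper bdd_above_abs[of _ _ "L + 2 * K"] bnd) auto
      with U[OF t] show "b t + (expectation (\<phi> t) - \<phi> t z) \<le> ?U / 2 + (SUP t\<in>T. b t - 2 * \<phi> t z) / 2"
        by (simp add: field_simps)
    qed
  qed simp
  also have "\<dots> = ?U / 2 + (\<integral>z. (SUP t\<in>T. b t - 2 * \<phi> t z) \<partial>M) / 2"
    using int(2) by (simp add: prob_space)
  finally show ?thesis by (simp add: add_divide_distrib)
qed

lemma abs_offset_sum:
  assumes "\<bar>b\<bar> \<le> L" "finite I" "\<And>i. i \<in> I \<Longrightarrow> \<bar>f i\<bar> \<le> 2 * K"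
  shows "\<bar>b + (\<Sum>i\<in>I. f i)\<bar> \<le> L + real (card I) * (2 * K)"
  using abs_sum_le_card[of I f "2 * K"] assms by (simp add: abs_le_iff)

text \<open>\<open>F\<close> may vary with the coordinate because \<open>symmetrize\<close> passes
  through sums in which one term is centred and the others carry signs.\<close>

lemma
  assumes I: "finite I" and b: "\<And>t. t \<in> T \<Longrightarrow> \<bar>b t\<bar> \<le> L"
    and F: "\<And>t i. \<lbrakk>t \<in> T; i \<in> I\<rbrakk> \<Longrightarrow> F t i \<in> borel_measurable M"
    and K: "\<And>t i z. \<lbrakk>t \<in> T; i \<in> I; z \<in> space M\<rbrakk> \<Longrightarrow> \<bar>F t i z\<bar> \<le> 2 * K"
  shows borel_measurable_SUP_sum:
      "(\<lambda>x. SUP t\<in>T. b t + (\<Sum>i\<in>I. F t i (x i))) \<in> borel_measurable (Pi\<^sub>M I (\<lambda>_. M))"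
    and abs_SUP_sum_le: "x \<in> space (Pi\<^sub>M I (\<lambda>_. M)) \<Longrightarrow>
      \<bar>SUP t\<in>T. b t + (\<Sum>i\<in>I. F t i (x i))\<bar> \<le> L + real (card I) * (2 * K)"
proof -
  have bnd: "\<bar>b t + (\<Sum>i\<in>I. F t i (x i))\<bar> \<le> L + real (card I) * (2 * K)"
    if "x \<in> space (Pi\<^sub>M I (\<lambda>_. M))" "t \<in> T" for x t
    using that I by (intro abs_offset_sum b K) (auto simp: space_PiM)
  have Fm: "(\<lambda>x. F t i (x i)) \<in> borel_measurable (Pi\<^sub>M I (\<lambda>_. M))" if "t \<in> T" "i \<in> I" for t i
    using measurable_compose[OF measurable_component_singleton[OF that(2)] F[OF that]] .
  show "(\<lambda>x. SUP t\<in>T. b t + (\<Sum>i\<in>I. F t i (x i))) \<in> borel_measurable (Pi\<^sub>M I (\<lambda>_. M))"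
    using T by (intro borel_measurable_cSUP bdd_above_abs[OF bnd] borel_measurable_add
        borel_measurable_sum Fm) auto
  show "\<bar>SUP t\<in>T. b t + (\<Sum>i\<in>I. F t i (x i))\<bar> \<le> L + real (card I) * (2 * K)"
    if "x \<in> space (Pi\<^sub>M I (\<lambda>_. M))"
    using T that by (intro abs_cSUP_le bnd)
qed

text \<open>Coordinates are symmetrized one at a time, without a ghost sample. Terms of coordinates
  that are held fixed are absorbed into the offset \<open>b\<close>, which therefore varies in the
  induction.\<close>

lemma symmetrize:
  assumes I: "finite I" and b: "\<And>t. t \<in> T \<Longrightarrow> \<bar>b t\<bar> \<le> L"
  shows "2 ^ card I * (\<integral>x. (SUP t\<in>T. b t + (\<Sum>i\<in>I. expectation (\<phi> t) - \<phi> t (x i))) \<partial>Pi\<^sub>M I (\<lambda>_. M))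
    \<le> (\<Sum>A\<in>Pow I. \<integral>x. (SUP t\<in>T. b t + (\<Sum>i\<in>I. 2 * (rsign A i * \<phi> t (x i)))) \<partial>Pi\<^sub>M I (\<lambda>_. M))"
  using I b
proof (induction I arbitrary: b L)
  case empty
  then show ?case by simp
next
  case (insert i I)
  interpret I: prob_space "Pi\<^sub>M I (\<lambda>_. M)" by (rule prob_space_PiM_const)
  let ?PI = "Pi\<^sub>M I (\<lambda>_. M)" and ?PJ = "Pi\<^sub>M (insert i I) (\<lambda>_. M)"
  have fin: "finite (insert i I)" using insert.hyps by simp
  note b = insert.prems
  have sum_upd: "(\<Sum>j\<in>insert i I. F j ((x(i := y)) j)) = (\<Sum>j\<in>I. F j (x j)) + F i y"
    for F :: "_ \<Rightarrow> _ \<Rightarrow> real" and x y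
  proof -
    have "(\<Sum>j\<in>I. F j ((x(i := y)) j)) = (\<Sum>j\<in>I. F j (x j))"
      using insert.hyps by (intro sum.cong) auto
    then show ?thesis using insert.hyps by simp
  qed
  let ?D = "\<lambda>x. SUP t\<in>T. b t + (\<Sum>j\<in>insert i I. expectation (\<phi> t) - \<phi> t (x j))"
  let ?R = "\<lambda>A x. SUP t\<in>T. b t + (\<Sum>j\<in>insert i I. 2 * (rsign A j * \<phi> t (x j)))"
  \<comment> \<open>The hybrid between the two sides: coordinate \<open>i\<close> is still centred,
    the others already carry signs.\<close>
  let ?F = "\<lambda>A t j z. if j = i then expectation (\<phi> t) - \<phi> t z else 2 * (rsign A j * \<phi> t z)"
  let ?G = "\<lambda>A x. SUP t\<in>T. b t + (\<Sum>j\<in>insert i I. ?F A t j (x j))"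
  let ?N = "L + real (card (insert i I)) * (2 * K)"
  have D: "?D \<in> borel_measurable ?PJ" "\<And>x. x \<in> space ?PJ \<Longrightarrow> \<bar>?D x\<bar> \<le> ?N"
    using fin b by (rule borel_measurable_SUP_sum abs_SUP_sum_le; auto intro!: abs_deviation)+
  have R: "?R A \<in> borel_measurable ?PJ" "\<And>x. x \<in> space ?PJ \<Longrightarrow> \<bar>?R A x\<bar> \<le> ?N" for A
    using fin b by (rule borel_measurable_SUP_sum abs_SUP_sum_le; auto intro!: abs_two_rsign)+
  have G: "?G A \<in> borel_measurable ?PJ" "\<And>x. x \<in> space ?PJ \<Longrightarrow> \<bar>?G A x\<bar> \<le> ?N" for A
    using fin b by (rule borel_measurable_SUP_sum[where F = "?F A"] abs_SUP_sum_le[where F = "?F A"];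
        auto intro!: abs_deviation abs_two_rsign)+
  have Dupd: "?D (x(i := y)) = (SUP t\<in>T. (b t + (expectation (\<phi> t) - \<phi> t y))
      + (\<Sum>j\<in>I. expectation (\<phi> t) - \<phi> t (x j)))" for x y
    unfolding sum_upd[of "\<lambda>j z. expectation (\<phi> t) - \<phi> t z" x y for t] by (simp add: ac_simps)
  have sumF: "(\<Sum>j\<in>I. ?F A t j (x j)) = (\<Sum>j\<in>I. 2 * (rsign A j * \<phi> t (x j)))" for A t x
    using insert.hyps by (intro sum.cong) auto
  have Gupd: "?G A (x(i := y)) = (SUP t\<in>T. (b t + (\<Sum>j\<in>I. 2 * (rsign A j * \<phi> t (x j))))
      + (expectation (\<phi> t) - \<phi> t y))" for A x y
    unfolding sum_upd[of "?F A t" x y for t] sumF by (simp add: ac_simps)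
  have Gupd': "?G A (x(i := y)) = (SUP t\<in>T. (b t + (expectation (\<phi> t) - \<phi> t y))
      + (\<Sum>j\<in>I. 2 * (rsign A j * \<phi> t (x j))))" for A x y
    unfolding Gupd by (simp add: ac_simps)
  have sumR: "(\<Sum>j\<in>I. 2 * (rsign (insert i A) j * \<phi> t (x j))) = (\<Sum>j\<in>I. 2 * (rsign A j * \<phi> t (x j)))"
    for A t x
    using insert.hyps by (intro sum.cong) (auto simp: rsign_def)
  have Rupd: "?R A (x(i := y)) = (SUP t\<in>T. (b t + (\<Sum>j\<in>I. 2 * (rsign A j * \<phi> t (x j)))) - 2 * \<phi> t y)"
    "?R (insert i A) (x(i := y)) = (SUP t\<in>T. (b t + (\<Sum>j\<in>I. 2 * (rsign A j * \<phi> t (x j)))) + 2 * \<phi> t y)"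
    if "A \<in> Pow I" for A x y
  proof -
    have "i \<notin> A" using that insert.hyps by auto
    then show "?R A (x(i := y)) = (SUP t\<in>T. (b t + (\<Sum>j\<in>I. 2 * (rsign A j * \<phi> t (x j)))) - 2 * \<phi> t y)"
      "?R (insert i A) (x(i := y)) = (SUP t\<in>T. (b t + (\<Sum>j\<in>I. 2 * (rsign A j * \<phi> t (x j)))) + 2 * \<phi> t y)"
      unfolding sum_upd[of "\<lambda>j z. 2 * (rsign A j * \<phi> t z)" x y for t A] sumR
      by (simp_all add: rsign_def algebra_simps)
  qed
  \<comment> \<open>The induction hypothesis acts with coordinate \<open>i\<close> fixed,
    \<open>symmetrize_step\<close> with the others fixed; this exchange connects them.\<close>
  have Fub: "(\<integral>y. (\<integral>x. ?G A (x(i := y)) \<partial>?PI) \<partial>M) = (\<integral>x. (\<integral>y. ?G A (x(i := y)) \<partial>M) \<partial>?PI)" for A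
    by (rule trans[OF sym[OF integral_PiM_insert_rev[OF insert.hyps(1,2) G]]
          integral_PiM_insert[OF insert.hyps(1,2) G]])
  have "2 ^ card (insert i I) * (\<integral>x. ?D x \<partial>?PJ) = 2 * (\<integral>y. 2 ^ card I * (\<integral>x. ?D (x(i := y)) \<partial>?PI) \<partial>M)"
    using insert.hyps by (subst integral_PiM_insert_rev[OF insert.hyps(1,2) D]) auto
  also have "\<dots> \<le> 2 * (\<integral>y. (\<Sum>A\<in>Pow I. \<integral>x. ?G A (x(i := y)) \<partial>?PI) \<partial>M)"
  proof (intro mult_left_mono integral_mono integrable_mult_right Bochner_Integration.integrable_sum
      integrable_integral_section_rev[OF D] integrable_integral_section_rev[OF G])
    fix y assume y: "y \<in> space M"
    show "2 ^ card I * (\<integral>x. ?D (x(i := y)) \<partial>?PI) \<le> (\<Sum>A\<in>Pow I. \<integral>x. ?G A (x(i := y)) \<partial>?PI)"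
      unfolding Dupd Gupd'
    proof (rule insert.IH)
      fix t assume "t \<in> T"
      then show "\<bar>b t + (expectation (\<phi> t) - \<phi> t y)\<bar> \<le> L + 2 * K"
        using b[of t] abs_deviation[of t y] y by linarith
    qed
  qed simp_all
  also have "\<dots> = 2 * (\<Sum>A\<in>Pow I. \<integral>x. (\<integral>y. ?G A (x(i := y)) \<partial>M) \<partial>?PI)"
    by (subst Bochner_Integration.integral_sum[OF integrable_integral_section_rev[OF G]])
      (simp_all only: Fub)
  also have "\<dots> \<le> 2 * (\<Sum>A\<in>Pow I. \<integral>x. ((\<integral>y. ?R (insert i A) (x(i := y)) \<partial>M) + (\<integral>y. ?R A (x(i := y)) \<partial>M)) / 2 \<partial>?PI)"
  proof (intro mult_left_mono sum_mono integral_mono integrable_divide Bochner_Integration.integrable_add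
      integrable_integral_section[OF R] integrable_integral_section[OF G])
    fix A x assume A: "A \<in> Pow I" and x: "x \<in> space ?PI"
    show "(\<integral>y. ?G A (x(i := y)) \<partial>M)
        \<le> ((\<integral>y. ?R (insert i A) (x(i := y)) \<partial>M) + (\<integral>y. ?R A (x(i := y)) \<partial>M)) / 2"
      unfolding Gupd Rupd[OF A]
    proof (rule symmetrize_step)
      fix t assume "t \<in> T"
      then show "\<bar>b t + (\<Sum>j\<in>I. 2 * (rsign A j * \<phi> t (x j)))\<bar> \<le> L + real (card I) * (2 * K)"
        using insert.hyps x by (intro abs_offset_sum b abs_two_rsign) (auto simp: space_PiM)
    qed
  qed simp_all
  also have "\<dots> = (\<Sum>A\<in>Pow I. (\<integral>x. ?R A x \<partial>?PJ) + (\<integral>x. ?R (insert i A) x \<partial>?PJ))"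
    unfolding sum_distrib_left
    by (intro sum.cong refl)
      (simp only: integral_PiM_insert[OF insert.hyps(1,2) R]
        Bochner_Integration.integral_add[OF integrable_integral_section[OF R] integrable_integral_section[OF R]]
        integral_divide_zero, simp)
  also have "\<dots> = (\<Sum>A\<in>Pow (insert i I). \<integral>x. ?R A x \<partial>?PJ)"
    by (rule sum_Pow_insert_split[OF insert.hyps(1,2), symmetric])
  finally show ?case .
qed

end

subsection \<open>Weighted thresholds\<close>

text \<open>As the range of \<open>of_rat\<close>, the rationals turn into a quantifier over a
  countable type.\<close>

lemma pred_bex_Rats:
  fixes P :: "'a \<Rightarrow> real \<Rightarrow> bool"
  assumes [measurable]: "\<And>t. Measurable.pred M (\<lambda>x. P x t)"
  shows "Measurable.pred M (\<lambda>x. \<exists>t\<in>\<rat>. P x t)"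
  unfolding Rats_def by simp

text \<open>Linear in \<open>r\<close>, this avoids the quotient of weights: its sum over a sample
  is at most 0 exactly when the points with score above \<open>t\<close> carry at most a fraction
  \<alpha> of the total of \<open>r\<close>.\<close>

definition excess :: "('a \<Rightarrow> real) \<Rightarrow> ('a \<Rightarrow> real) \<Rightarrow> real \<Rightarrow> real \<Rightarrow> 'a \<Rightarrow> real" where
  "excess r s \<alpha> t z = r z * (of_bool (t < s z) - \<alpha>)"

locale bounded_weight = prob_space M for M :: "'a measure" +
  fixes r s :: "'a \<Rightarrow> real" and \<alpha> B :: real
  assumes r_measurable[measurable]: "r \<in> borel_measurable M"
    and s_measurable[measurable]: "s \<in> borel_measurable M"
    and r_bounded: "\<And>z. z \<in> space M \<Longrightarrow> 0 \<le> r z \<and> r z \<le> B"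
    and expectation_r: "expectation r = 1"
    and \<alpha>: "0 < \<alpha>" "\<alpha> < 1"
begin

text \<open>Two separate bounds, since their difference \<open>B\<close> is the increment in
  McDiarmid's inequality; the bound \<open>B\<close> on the absolute value would give only
  \<open>2 * B\<close>.\<close>

lemma excess_bounds:
  assumes "z \<in> space M"
  shows "- (\<alpha> * B) \<le> excess r s \<alpha> t z" "excess r s \<alpha> t z \<le> (1 - \<alpha>) * B"
proof -
  have "0 \<le> r z" "r z \<le> B" "0 \<le> B" using r_bounded[OF assms] by auto
  then have "\<alpha> * r z \<le> \<alpha> * B" "(1 - \<alpha>) * r z \<le> (1 - \<alpha>) * B"
    "0 \<le> \<alpha> * r z" "0 \<le> (1 - \<alpha>) * r z" "0 \<le> \<alpha> * B" "0 \<le> (1 - \<alpha>) * B"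
    using \<alpha> by (auto intro!: mult_left_mono)
  then show "- (\<alpha> * B) \<le> excess r s \<alpha> t z" "excess r s \<alpha> t z \<le> (1 - \<alpha>) * B"
    by (auto simp: excess_def of_bool_def algebra_simps)
qed

lemma B_ge_1: "1 \<le> B"
proof -
  have "expectation r \<le> expectation (\<lambda>_. B)"
    using r_bounded by (intro integral_mono integrable_bounded[of r B]) auto
  then show ?thesis by (simp add: expectation_r prob_space)
qed

sublocale bounded_class M \<rat> "excess r s \<alpha>" B
proof
  show "\<bar>excess r s \<alpha> t z\<bar> \<le> B" if "z \<in> space M" for t z
  proof -
    have "\<alpha> * B \<le> 1 * B" "(1 - \<alpha>) * B \<le> 1 * B"
      using \<alpha> B_ge_1 by (auto intro!: mult_right_mono)
    then show ?thesis
      using excess_bounds[OF that, of t] by linarith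
  qed
  show "excess r s \<alpha> t \<in> borel_measurable M" for t
    unfolding excess_def[abs_def] of_bool_def by measurable
qed (auto simp: countable_rat intro: Rats_0)

text \<open>One-sided, because only a calibration sum below its mean makes the threshold too small.
  A sum rather than an average, so that one point moves it by at most \<open>B\<close>.\<close>

definition sup_deviation :: "'i set \<Rightarrow> ('i \<Rightarrow> 'a) \<Rightarrow> real" where
  "sup_deviation I x = (SUP t\<in>\<rat>. \<Sum>i\<in>I. expectation (excess r s \<alpha> t) - excess r s \<alpha> t (x i))"

lemma
  assumes "finite I"
  shows borel_measurable_sup_deviation[measurable]: "sup_deviation I \<in> borel_measurable (Pi\<^sub>M I (\<lambda>_. M))"
    and abs_sup_deviation_le: "x \<in> space (Pi\<^sub>M I (\<lambda>_. M)) \<Longrightarrow> \<bar>sup_deviation I x\<bar> \<le> real (card I) * (2 * B)"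
  using borel_measurable_SUP_sum[OF assms, of "\<lambda>_. 0" 0 "\<lambda>t _ z. expectation (excess r s \<alpha> t) - excess r s \<alpha> t z"]
    abs_SUP_sum_le[OF assms, of "\<lambda>_. 0" 0 "\<lambda>t _ z. expectation (excess r s \<alpha> t) - excess r s \<alpha> t z" x]
  by (simp_all add: sup_deviation_def[abs_def] abs_deviation)

lemma sup_deviation_upper:
  assumes "finite I" "x \<in> space (Pi\<^sub>M I (\<lambda>_. M))" "t \<in> \<rat>"
  shows "(\<Sum>i\<in>I. expectation (excess r s \<alpha> t) - excess r s \<alpha> t (x i)) \<le> sup_deviation I x"
  unfolding sup_deviation_def using assms
  by (intro cSUP_upper bdd_above_abs[of _ _ "real (card I) * (2 * B)"] abs_sum_le_card abs_deviation)
    (auto simp: space_PiM)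

lemma sup_deviation_upd:
  assumes I: "finite I" and x: "x \<in> space (Pi\<^sub>M I (\<lambda>_. M))" and y: "y \<in> space (Pi\<^sub>M I (\<lambda>_. M))"
    and i: "i \<in> I" and eq: "\<And>j. j \<in> I - {i} \<Longrightarrow> x j = y j"
  shows "sup_deviation I x \<le> sup_deviation I y + B"
  unfolding sup_deviation_def[of I x]
proof (rule cSUP_least)
  fix t :: real assume t: "t \<in> \<rat>"
  let ?f = "\<lambda>z. expectation (excess r s \<alpha> t) - excess r s \<alpha> t z"
  have "x i \<in> space M" "y i \<in> space M" using x y i by (auto simp: space_PiM)
  then have "?f (x i) \<le> ?f (y i) + B"
    using excess_bounds[of "x i" t] excess_bounds[of "y i" t] by (simp add: algebra_simps)
  moreover have "(\<Sum>j\<in>I - {i}. ?f (x j)) = (\<Sum>j\<in>I - {i}. ?f (y j))"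
    using eq by (intro sum.cong) auto
  ultimately have "(\<Sum>j\<in>I. ?f (x j)) \<le> (\<Sum>j\<in>I. ?f (y j)) + B"
    using I i by (simp add: sum.remove[of I i])
  then show "(\<Sum>j\<in>I. ?f (x j)) \<le> sup_deviation I y + B"
    using sup_deviation_upper[OF I y t] by linarith
qed (auto intro: Rats_0)

text \<open>For a fixed sample, \<open>excess\<close> is \<open>(1 - \<alpha>) * r\<close> minus
  \<open>r\<close> restricted to \<open>s \<le> t\<close>. The first part is free of
  \<open>t\<close> and vanishes in the sum over signs; the second is a half-line sum of the walk
  with steps \<open>- r\<close>.\<close>

lemma sum_Pow_SUP_excess_le:
  fixes x :: "'i \<Rightarrow> 'a"
  assumes I: "finite I" and c: "c > 0"
  shows "(\<Sum>A\<in>Pow I. SUP t\<in>\<rat>. \<Sum>i\<in>I. 2 * (rsign A i * excess r s \<alpha> t (x i)))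
    \<le> 2 ^ card I * (4 * (\<Sum>i\<in>I. (r (x i))\<^sup>2) / c + c)"
proof -
  obtain M where Mt: "\<And>A t. A \<in> Pow I \<Longrightarrow> (\<Sum>i\<in>{i\<in>I. s (x i) \<le> t}. rsign A i * (- r (x i))) \<le> M A"
    and Msum: "(\<Sum>A\<in>Pow I. 2 * M A) \<le> 2 ^ card I * (4 * (\<Sum>i\<in>I. (- r (x i))\<^sup>2) / c + c)"
    using rademacher_maximal[OF I c, where s = "\<lambda>i. s (x i)" and a = "\<lambda>i. - r (x i)"] by blast
  have "(\<Sum>A\<in>Pow I. SUP t\<in>\<rat>. \<Sum>i\<in>I. 2 * (rsign A i * excess r s \<alpha> t (x i)))
      \<le> (\<Sum>A\<in>Pow I. 2 * (1 - \<alpha>) * (\<Sum>i\<in>I. rsign A i * r (x i)) + 2 * M A)"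
  proof (intro sum_mono cSUP_least)
    fix A t assume A: "A \<in> Pow I"
    have "(\<Sum>i\<in>I. 2 * (rsign A i * excess r s \<alpha> t (x i)))
      = (\<Sum>i\<in>I. 2 * (1 - \<alpha>) * (rsign A i * r (x i))
          + 2 * (if s (x i) \<le> t then rsign A i * (- r (x i)) else 0))"
      by (intro sum.cong) (auto simp: excess_def of_bool_def algebra_simps)
    also have "\<dots> = 2 * (1 - \<alpha>) * (\<Sum>i\<in>I. rsign A i * r (x i))
        + 2 * (\<Sum>i\<in>{i\<in>I. s (x i) \<le> t}. rsign A i * (- r (x i)))"
      using I by (simp only: sum.distrib sum.inter_filter flip: sum_distrib_left)
    finally show "(\<Sum>i\<in>I. 2 * (rsign A i * excess r s \<alpha> t (x i)))
      \<le> 2 * (1 - \<alpha>) * (\<Sum>i\<in>I. rsign A i * r (x i)) + 2 * M A"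
      using Mt[OF A, of t] by linarith
  qed (auto intro: Rats_0)
  also have "\<dots> = (\<Sum>A\<in>Pow I. 2 * M A)"
    using sum_Pow_rsign_linear[OF I, of "\<lambda>i. r (x i)"]
    by (simp add: sum.distrib flip: sum_distrib_left)
  finally show ?thesis using Msum by simp
qed

lemma integral_sup_deviation_le:
  fixes I :: "'i set"
  assumes I: "finite I" "I \<noteq> {}"
  shows "(\<integral>x. sup_deviation I x \<partial>Pi\<^sub>M I (\<lambda>_. M)) \<le> 4 * sqrt (real (card I) * B)"
proof -
  let ?PI = "Pi\<^sub>M I (\<lambda>_. M)"
  interpret I: prob_space ?PI by (rule prob_space_PiM_const)
  \<comment> \<open>The minimiser of \<open>4 * card I * B / c + c\<close>, whose value there is
    \<open>2 * c\<close>.\<close>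
  define c where "c = 2 * sqrt (real (card I) * B)"
  have m: "real (card I) > 0" using I by (simp add: card_gt_0_iff)
  have c: "c > 0" and cc: "c * c = 4 * (real (card I) * B)"
    using m B_ge_1 by (auto simp: c_def)
  have rm: "(\<lambda>x. r (x i)) \<in> borel_measurable ?PI" if "i \<in> I" for i
    using measurable_compose[OF measurable_component_singleton[OF that] r_measurable] .
  have r2: "\<bar>(r (x i))\<^sup>2\<bar> \<le> B\<^sup>2" if "x \<in> space ?PI" "i \<in> I" for x i
    using that r_bounded[of "x i"] by (auto simp: space_PiM intro!: power_mono)
  have int_r2: "integrable ?PI (\<lambda>x. (r (x i))\<^sup>2)" if "i \<in> I" for i
    using rm[OF that] r2[OF _ that] by (intro I.integrable_bounded[of _ "B\<^sup>2"] borel_measurable_power)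
  \<comment> \<open>From \<open>r\<^sup>2 \<le> B * r\<close> and \<open>expectation r = 1\<close>;
    the pointwise bound alone would give \<open>B\<^sup>2\<close> and a mean deviation of order
    \<open>B / sqrt m\<close>.\<close>
  have exp_r2: "(\<integral>x. (r (x i))\<^sup>2 \<partial>?PI) \<le> B" if i: "i \<in> I" for i
  proof -
    have "(\<integral>x. (r (x i))\<^sup>2 \<partial>?PI) = (\<integral>z. (r z)\<^sup>2 \<partial>distr ?PI M (\<lambda>x. x i))"
      using i by (intro integral_distr[symmetric]) auto
    also have "distr ?PI M (\<lambda>x. x i) = M"
      using i by (intro distr_PiM_component prob_space_axioms)
    also have "(\<integral>z. (r z)\<^sup>2 \<partial>M) \<le> (\<integral>z. B * r z \<partial>M)"
      using r_bounded B_ge_1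
      by (intro integral_mono integrable_bounded[of _ "B\<^sup>2"] integrable_mult_right integrable_bounded[of r B])
        (auto simp: power2_eq_square intro!: mult_right_mono mult_mono)
    finally show ?thesis by (simp add: expectation_r)
  qed
  let ?S = "\<lambda>A x. SUP t\<in>\<rat>. 0 + (\<Sum>i\<in>I. 2 * (rsign A i * excess r s \<alpha> t (x i)))"
  have S: "integrable ?PI (?S A)" for A
  proof (rule I.integrable_bounded)
    show "?S A \<in> borel_measurable ?PI"
      using I(1) by (rule borel_measurable_SUP_sum[of _ _ 0]) (auto intro!: abs_two_rsign)
    show "\<bar>?S A x\<bar> \<le> 0 + real (card I) * (2 * B)" if "x \<in> space ?PI" for x
      using I(1) _ _ _ that by (rule abs_SUP_sum_le) (auto intro!: abs_two_rsign)
  qed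
  have "2 ^ card I * (\<integral>x. sup_deviation I x \<partial>?PI) \<le> (\<Sum>A\<in>Pow I. \<integral>x. ?S A x \<partial>?PI)"
    using symmetrize[OF I(1), of "\<lambda>_. 0" 0] by (simp add: sup_deviation_def)
  also have "\<dots> = (\<integral>x. (\<Sum>A\<in>Pow I. ?S A x) \<partial>?PI)"
    using S by (intro Bochner_Integration.integral_sum[symmetric])
  also have "\<dots> \<le> (\<integral>x. 2 ^ card I * (4 * (\<Sum>i\<in>I. (r (x i))\<^sup>2) / c + c) \<partial>?PI)"
    using sum_Pow_SUP_excess_le[OF I(1) c] S int_r2
    by (intro integral_mono Bochner_Integration.integrable_sum integrable_mult_right
        Bochner_Integration.integrable_add integrable_divide) auto
  also have "\<dots> = 2 ^ card I * (4 * (\<Sum>i\<in>I. \<integral>x. (r (x i))\<^sup>2 \<partial>?PI) / c + c)"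
    using int_r2 by (simp add: I.prob_space Bochner_Integration.integral_sum)
  also have "\<dots> \<le> 2 ^ card I * (4 * (\<Sum>i\<in>I. B) / c + c)"
    using c exp_r2 by (intro mult_left_mono add_right_mono divide_right_mono sum_mono) auto
  also have "4 * (\<Sum>i\<in>I. B) / c + c = 2 * c"
    using c cc by (simp add: field_simps)
  finally show ?thesis by (simp add: c_def)
qed

text \<open>\<open>c\<close> is any predicate of the threshold alone, so a condition on the
  population enters as a constant for each \<open>t\<close>.\<close>

lemma sets_threshold_deviation:
  shows "{x \<in> space (Pi\<^sub>M I (\<lambda>_. M)). \<exists>t\<in>\<rat>.
      (1 - \<alpha>) * (\<Sum>i\<in>I. r (x i)) \<le> (\<Sum>i\<in>I. r (x i) * of_bool (s (x i) \<le> t)) \<and> c t} \<in> sets (Pi\<^sub>M I (\<lambda>_. M))"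
proof -
  have comp: "(\<lambda>x. \<Sum>i\<in>I. g (x i)) \<in> borel_measurable (Pi\<^sub>M I (\<lambda>_. M))"
    if "g \<in> borel_measurable M" for g :: "'a \<Rightarrow> real"
    by (intro borel_measurable_sum measurable_compose[where f = "\<lambda>x. x _", OF _ that]
        measurable_component_singleton)
  have 1: "(\<lambda>x. \<Sum>i\<in>I. r (x i)) \<in> borel_measurable (Pi\<^sub>M I (\<lambda>_. M))"
    by (rule comp) simp
  have 2: "(\<lambda>x. \<Sum>i\<in>I. r (x i) * of_bool (s (x i) \<le> t)) \<in> borel_measurable (Pi\<^sub>M I (\<lambda>_. M))" for t
    unfolding of_bool_def by (rule comp[of "\<lambda>z. r z * (if s z \<le> t then 1 else 0)"]) measurable
  have "Measurable.pred (Pi\<^sub>M I (\<lambda>_. M)) (\<lambda>x. \<exists>t\<in>\<rat>.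
      (1 - \<alpha>) * (\<Sum>i\<in>I. r (x i)) \<le> (\<Sum>i\<in>I. r (x i) * of_bool (s (x i) \<le> t)) \<and> c t)"
    by (intro pred_bex_Rats pred_intros_logic borel_measurable_le[OF borel_measurable_times 2, folded pred_def]
        1 borel_measurable_const) simp
  then show ?thesis by (simp add: pred_def)
qed

text \<open>The bad event is that calibration accepts a threshold above which the population still
  has too much mass. Acceptance makes the sum of \<open>excess\<close> at most 0, hence
  \<open>sup_deviation\<close> at least \<open>card I\<close> times the mean of
  \<open>excess\<close>, which is more than \<open>u\<close> above the bound on the mean of
  \<open>sup_deviation\<close>.\<close>

lemma threshold_deviation:
  fixes I :: "'i set"
  assumes I: "finite I" "I \<noteq> {}" and u: "u > 0"
  shows "emeasure (Pi\<^sub>M I (\<lambda>_. M)) {x \<in> space (Pi\<^sub>M I (\<lambda>_. M)). \<exists>t\<in>\<rat>.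
      (1 - \<alpha>) * (\<Sum>i\<in>I. r (x i)) \<le> (\<Sum>i\<in>I. r (x i) * of_bool (s (x i) \<le> t))
      \<and> expectation (\<lambda>z. r z * of_bool (t < s z)) > \<alpha> + (4 * sqrt (real (card I) * B) + u) / real (card I)}
    \<le> ennreal (exp (- 2 * u\<^sup>2 / (real (card I) * B\<^sup>2)))"
proof -
  let ?PI = "Pi\<^sub>M I (\<lambda>_. M)"
  have m: "real (card I) > 0" using I by (simp add: card_gt_0_iff)
  have exc: "expectation (excess r s \<alpha> t) = expectation (\<lambda>z. r z * of_bool (t < s z)) - \<alpha>" for t
  proof -
    have "expectation (excess r s \<alpha> t) = expectation (\<lambda>z. r z * of_bool (t < s z) - \<alpha> * r z)"
      by (intro Bochner_Integration.integral_cong) (auto simp: excess_def algebra_simps)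
    also have "\<dots> = expectation (\<lambda>z. r z * of_bool (t < s z)) - \<alpha> * expectation r"
      using r_bounded B_ge_1
      by (subst Bochner_Integration.integral_diff)
        (auto intro!: integrable_bounded[of _ B] integrable_mult_right simp: of_bool_def)
    finally show ?thesis by (simp add: expectation_r)
  qed
  have "emeasure ?PI {x \<in> space ?PI. \<exists>t\<in>\<rat>.
      (1 - \<alpha>) * (\<Sum>i\<in>I. r (x i)) \<le> (\<Sum>i\<in>I. r (x i) * of_bool (s (x i) \<le> t))
      \<and> expectation (\<lambda>z. r z * of_bool (t < s z)) > \<alpha> + (4 * sqrt (real (card I) * B) + u) / real (card I)}
    \<le> emeasure ?PI {x \<in> space ?PI. sup_deviation I x \<ge> (\<integral>x. sup_deviation I x \<partial>?PI) + u}"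
  proof (intro emeasure_mono subsetI)
    fix x assume "x \<in> {x \<in> space ?PI. \<exists>t\<in>\<rat>.
      (1 - \<alpha>) * (\<Sum>i\<in>I. r (x i)) \<le> (\<Sum>i\<in>I. r (x i) * of_bool (s (x i) \<le> t))
      \<and> expectation (\<lambda>z. r z * of_bool (t < s z)) > \<alpha> + (4 * sqrt (real (card I) * B) + u) / real (card I)}"
    then obtain t where x: "x \<in> space ?PI" and t: "t \<in> \<rat>"
      and emp: "(1 - \<alpha>) * (\<Sum>i\<in>I. r (x i)) \<le> (\<Sum>i\<in>I. r (x i) * of_bool (s (x i) \<le> t))"
      and pop: "expectation (\<lambda>z. r z * of_bool (t < s z)) > \<alpha> + (4 * sqrt (real (card I) * B) + u) / real (card I)"
      by auto
    have "(\<Sum>i\<in>I. excess r s \<alpha> t (x i))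
        = (\<Sum>i\<in>I. (1 - \<alpha>) * r (x i) - r (x i) * of_bool (s (x i) \<le> t))"
      by (intro sum.cong) (auto simp: excess_def of_bool_def algebra_simps)
    also have "\<dots> \<le> 0"
      using emp by (simp add: sum_subtractf sum_distrib_left)
    finally have "real (card I) * expectation (excess r s \<alpha> t)
        \<le> (\<Sum>i\<in>I. expectation (excess r s \<alpha> t) - excess r s \<alpha> t (x i))"
      by (simp add: sum_subtractf)
    also have "\<dots> \<le> sup_deviation I x"
      using I(1) x t by (rule sup_deviation_upper)
    finally have "real (card I) * expectation (excess r s \<alpha> t) \<le> sup_deviation I x" .
    moreover have "4 * sqrt (real (card I) * B) + u < real (card I) * expectation (excess r s \<alpha> t)"
      using pop m unfolding exc by (simp add: field_simps)
    ultimately show "x \<in> {x \<in> space ?PI. sup_deviation I x \<ge> (\<integral>x. sup_deviation I x \<partial>?PI) + u}"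
      using x integral_sup_deviation_le[OF I] by simp
  qed (use I in measurable)
  also have "\<dots> \<le> ennreal (exp (- 2 * u\<^sup>2 / (real (card I) * B\<^sup>2)))"
  proof (rule mcdiarmid_ineq[OF I u])
    show "B > 0" using B_ge_1 by simp
    show "\<bar>sup_deviation I (x(i := y)) - sup_deviation I x\<bar> \<le> B"
      if x: "x \<in> space ?PI" and i: "i \<in> I" and y: "y \<in> space M" for x i y
    proof -
      have xy: "x(i := y) \<in> space ?PI"
        using PiM_upd_space[OF x y, of i] i by (simp add: insert_absorb)
      show ?thesis
        using sup_deviation_upd[OF I(1) x xy i] sup_deviation_upd[OF I(1) xy x i]
        by (simp add: abs_le_iff)
    qed
  qed (use I in \<open>auto intro: abs_sup_deviation_le\<close>)
  finally show ?thesis .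
qed

end

subsection \<open>Conditional miscoverage\<close>

lemma miscoverage_imp_threshold:
  fixes D :: "nat \<Rightarrow> 'x \<times> 'y" and f :: "'y \<Rightarrow> 'y \<Rightarrow> real"
  assumes r: "\<And>z. 0 \<le> r z" and rX: "\<And>x. 0 \<le> rX x" and \<alpha>: "\<alpha> < 1"
    and y: "snd z \<in> space MY" and mis: "snd z \<notin> split_conformal_set MY r rX T f n m \<alpha> D (fst z)"
  defines "s \<equiv> score f (T (restrict D {1..n - m}))" and "I \<equiv> {n - m + 1..n}"
  shows "\<exists>t\<in>\<rat>. (1 - \<alpha>) * (\<Sum>i\<in>I. r (D i)) \<le> (\<Sum>i\<in>I. r (D i) * of_bool (s (D i) \<le> t)) \<and> t < s z"
proof -
  have "weighted_quantile r rX s I D (fst z) (1 - \<alpha>) < ereal (s z)"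
    using y mis by (simp add: split_conformal_set_def Let_def s_def I_def not_le)
  then obtain e where e: "1 - \<alpha> \<le> weighted_cdf r rX s I D (fst z) e" "e < ereal (s z)"
    by (auto simp: weighted_quantile_def Inf_less_iff)
  \<comment> \<open>\<open>e\<close> need not be rational; moving up to a rational below the score
    only enlarges the calibration sum.\<close>
  from e(2) obtain q :: rat where q: "e < ereal (of_rat q)" "ereal (of_rat q) < ereal (s z)"
    using ereal_dense3 by blast
  define t :: real where "t = of_rat q"
  let ?W = "total_weight r rX I D (fst z)"
  \<comment> \<open>The mass of the test point sits at \<infinity>, so below that level its weight
    survives only in the denominator.\<close>
  have e_fin: "e \<noteq> \<infinity>" using e(2) by auto
  have cdf: "weighted_cdf r rX s I D (fst z) e = (\<Sum>i\<in>I. r (D i) * of_bool (ereal (s (D i)) \<le> e)) / ?W"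
    using e_fin by (simp add: weighted_cdf_def calib_weight_def sum_divide_distrib)
  \<comment> \<open>With total weight 0, division by zero would make the cdf 0, which is below the
    positive level \<open>1 - \<alpha>\<close>.\<close>
  have W: "?W > 0"
  proof -
    have "?W \<ge> 0"
      unfolding total_weight_def by (intro add_nonneg_nonneg sum_nonneg r rX)
    moreover have "?W \<noteq> 0"
      using e(1) \<alpha> unfolding cdf by auto
    ultimately show ?thesis by simp
  qed
  have "(1 - \<alpha>) * (\<Sum>i\<in>I. r (D i)) \<le> (1 - \<alpha>) * ?W"
    using rX \<alpha> by (intro mult_left_mono) (auto simp: total_weight_def)
  also have "\<dots> \<le> (\<Sum>i\<in>I. r (D i) * of_bool (ereal (s (D i)) \<le> e))"
    using e(1) W unfolding cdf by (simp add: pos_le_divide_eq)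
  also have "\<dots> \<le> (\<Sum>i\<in>I. r (D i) * of_bool (s (D i) \<le> t))"
  proof (intro sum_mono mult_left_mono r)
    fix i
    have "s (D i) \<le> t" if "ereal (s (D i)) \<le> e"
      using order.trans[OF that less_imp_le[OF q(1)]] by (simp add: t_def)
    then show "of_bool (ereal (s (D i)) \<le> e) \<le> (of_bool (s (D i) \<le> t) :: real)"
      by simp
  qed
  finally show ?thesis
    using q(2) by (intro bexI[of _ t]) (auto simp: t_def)
qed

text \<open>Finitely many thresholds reduce to their minimum, which lies in \<open>G\<close>; as
  \<open>G\<close> itself may have no least element, continuity from below does the rest. The
  contrapositive extracts one offending threshold.\<close>

lemma (in finite_measure) measure_Union_thresholds_le:
  fixes s :: "'a \<Rightarrow> real"
  assumes [measurable]: "s \<in> borel_measurable M" and G: "countable G" and c: "0 \<le> c"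
    and le: "\<And>t. t \<in> G \<Longrightarrow> measure M {z \<in> space M. t < s z} \<le> c"
  shows "measure M {z \<in> space M. \<exists>t\<in>G. t < s z} \<le> c"
proof (cases "G = {}")
  case False
  define A where "A k = {z \<in> space M. \<exists>j\<le>k. from_nat_into G j < s z}" for k
  have A: "measure M (A k) \<le> c" for k
  proof -
    let ?t = "Min (from_nat_into G ` {..k})"
    have "A k = {z \<in> space M. ?t < s z}"
      by (auto simp: A_def Min_less_iff)
    moreover have "?t \<in> G"
    proof -
      have "?t \<in> from_nat_into G ` {..k}"
        by (intro Min_in) auto
      also have "\<dots> \<subseteq> G"
        using from_nat_into[OF False] by (rule image_subsetI)
      finally show ?thesis .
    qed
    ultimately show ?thesis using le by simp
  qed
  have "(\<lambda>k. measure M (A k)) \<longlonglongrightarrow> measure M (\<Union>k. A k)"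
  proof (rule finite_Lim_measure_incseq)
    show "range A \<subseteq> sets M" unfolding A_def by auto
    show "incseq A" unfolding A_def incseq_def by (auto intro: order.trans)
  qed
  moreover have "(\<Union>k. A k) = {z \<in> space M. \<exists>t\<in>G. t < s z}"
    using from_nat_into[OF False] from_nat_into_surj[OF G] by (fastforce simp: A_def)
  ultimately show ?thesis
    using A by (intro LIMSEQ_le_const2) auto
qed (use c in simp)

text \<open>The library's \<open>indep_var\<close> needs both variables to have the same type, hence \<open>indep_set\<close>.\<close>

lemma (in prob_space) distr_pair_indep_set:
  assumes X[measurable]: "X \<in> M \<rightarrow>\<^sub>M S" and Y[measurable]: "Y \<in> M \<rightarrow>\<^sub>M N"
    and ind: "indep_set (sets (vimage_algebra (space M) X S)) (sets (vimage_algebra (space M) Y N))"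
  shows "distr M S X \<Otimes>\<^sub>M distr M N Y = distr M (S \<Otimes>\<^sub>M N) (\<lambda>x. (X x, Y x))"
proof (rule pair_measure_eqI)
  interpret X: prob_space "distr M S X" by (rule prob_space_distr[OF X])
  interpret Y: prob_space "distr M N Y" by (rule prob_space_distr[OF Y])
  show "sigma_finite_measure (distr M S X)" "sigma_finite_measure (distr M N Y)"
    by unfold_locales
  fix A B assume "A \<in> sets (distr M S X)" "B \<in> sets (distr M N Y)"
  then have A[measurable]: "A \<in> sets S" and B[measurable]: "B \<in> sets N" by auto
  have "prob ((X -` A \<inter> space M) \<inter> (Y -` B \<inter> space M)) = prob (X -` A \<inter> space M) * prob (Y -` B \<inter> space M)"
    using ind A B by (intro indep_setD[OF ind] in_vimage_algebra)
  moreover have "(\<lambda>x. (X x, Y x)) -` (A \<times> B) \<inter> space M = (X -` A \<inter> space M) \<inter> (Y -` B \<inter> space M)"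
    by auto
  ultimately show "emeasure (distr M S X) A * emeasure (distr M N Y) B
      = emeasure (distr M (S \<Otimes>\<^sub>M N) (\<lambda>x. (X x, Y x))) (A \<times> B)"
    by (simp add: emeasure_distr emeasure_eq_measure ennreal_mult)
qed (simp cong: sets_pair_measure_cong)

text \<open>Events of the conditioning algebra are preimages under \<open>X\<close> of sets
  \<open>C0\<close>. By independence the joint law is a product, and Fubini on the part of
  \<open>A\<close> over \<open>C0\<close> gives the characterising identity.\<close>

lemma (in prob_space) real_cond_exp_indep_pair:
  assumes X[measurable]: "X \<in> M \<rightarrow>\<^sub>M S" and Y[measurable]: "Y \<in> M \<rightarrow>\<^sub>M N"
    and ind: "indep_set (sets (vimage_algebra (space M) X S)) (sets (vimage_algebra (space M) Y N))"
    and A[measurable]: "A \<in> sets (S \<Otimes>\<^sub>M N)"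
  shows "AE \<omega> in M. real_cond_exp M (vimage_algebra (space M) X S)
      (indicator {\<omega> \<in> space M. (X \<omega>, Y \<omega>) \<in> A}) \<omega> = measure (distr M N Y) (Pair (X \<omega>) -` A)"
proof -
  note dist = distr_pair_indep_set[OF X Y ind]
  let ?F = "vimage_algebra (space M) X S"
  let ?E = "{\<omega> \<in> space M. (X \<omega>, Y \<omega>) \<in> A}"
  let ?h = "\<lambda>\<omega>. measure (distr M N Y) (Pair (X \<omega>) -` A)"
  interpret Y: prob_space "distr M N Y" by (rule prob_space_distr[OF Y])
  have sub: "subalgebra M ?F"
    using sets_image_in_sets[OF refl X] by (simp add: subalgebra_def)
  interpret finite_measure_subalgebra M ?F
    by unfold_locales (rule sub)
  have XF: "X \<in> ?F \<rightarrow>\<^sub>M S"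
    by (intro measurable_vimage_algebra1 Pi_I measurable_space[OF X])
  have [measurable]: "(\<lambda>x. emeasure (distr M N Y) (Pair x -` A)) \<in> borel_measurable S"
    by (rule Y.measurable_emeasure_Pair) simp
  have m: "(\<lambda>x. measure (distr M N Y) (Pair x -` A)) \<in> borel_measurable S"
    unfolding measure_def by measurable
  have hm: "?h \<in> borel_measurable M" and hF: "?h \<in> borel_measurable ?F"
    using measurable_compose[OF X m] measurable_compose[OF XF m] by auto
  show ?thesis
  proof (rule real_cond_exp_charact)
    show "integrable M (indicator ?E :: _ \<Rightarrow> real)"
      by (rule integrable_const_bound[of _ 1]) auto
    show "integrable M ?h"
      using hm by (rule integrable_const_bound[of _ 1, rotated]) simp
    show "?h \<in> borel_measurable ?F" by (rule hF)
    fix C assume "C \<in> sets ?F"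
    then obtain C0 where C: "C = X -` C0 \<inter> space M" and C0[measurable]: "C0 \<in> sets S"
      using sets_vimage_algebra2[of X "space M" S] measurable_space[OF X] by auto
    have Cm[measurable]: "C \<in> sets M" unfolding C by measurable
    have "emeasure M (C \<inter> ?E) = emeasure (distr M (S \<Otimes>\<^sub>M N) (\<lambda>x. (X x, Y x))) (A \<inter> (C0 \<times> space N))"
      using measurable_space[OF Y] by (subst emeasure_distr) (auto simp: C intro!: arg_cong[of _ _ "emeasure M"])
    also have "\<dots> = (\<integral>\<^sup>+x. emeasure (distr M N Y) (Pair x -` (A \<inter> (C0 \<times> space N))) \<partial>distr M S X)"
      unfolding dist[symmetric] by (intro Y.emeasure_pair_measure_alt) simp
    also have "\<dots> = (\<integral>\<^sup>+x. ennreal (indicator C0 x * measure (distr M N Y) (Pair x -` A)) \<partial>distr M S X)"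
    proof (intro nn_integral_cong)
      fix x
      have "Pair x -` (A \<inter> (C0 \<times> space N)) = (if x \<in> C0 then Pair x -` A else {})"
        using sets.sets_into_space[OF A] by (auto simp: space_pair_measure)
      then show "emeasure (distr M N Y) (Pair x -` (A \<inter> (C0 \<times> space N)))
        = ennreal (indicator C0 x * measure (distr M N Y) (Pair x -` A))"
        by (simp add: Y.emeasure_eq_measure)
    qed
    also have "\<dots> = (\<integral>\<^sup>+\<omega>. ennreal (indicator C0 (X \<omega>) * ?h \<omega>) \<partial>M)"
      using m by (intro nn_integral_distr) auto
    also have "\<dots> = (\<integral>\<^sup>+\<omega>. ennreal (indicator C \<omega> * ?h \<omega>) \<partial>M)"
      by (intro nn_integral_cong) (auto simp: C indicator_def)
    finally have eq: "emeasure M (C \<inter> ?E) = (\<integral>\<^sup>+\<omega>. ennreal (indicator C \<omega> * ?h \<omega>) \<partial>M)" .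
    have "(\<integral>\<omega>\<in>C. indicator ?E \<omega> \<partial>M) = measure M (C \<inter> ?E)"
      by (simp add: set_lebesgue_integral_def indicator_inter_arith[symmetric] Int_absorb2 sets.sets_into_space)
    also have "\<dots> = (\<integral>\<omega>. indicator C \<omega> * ?h \<omega> \<partial>M)"
      unfolding measure_def[of M] eq using hm
      by (intro integral_eq_nn_integral[symmetric]) auto
    finally show "(\<integral>\<omega>\<in>C. indicator ?E \<omega> \<partial>M) = (\<integral>\<omega>\<in>C. ?h \<omega> \<partial>M)"
      by (simp add: set_lebesgue_integral_def)
  qed
qed

text \<open>The conditional probability is bounded by a function \<open>H\<close> of the sample
  alone, and the tail of \<open>H\<close> is computed on the product space with the training points
  frozen. \<open>rX\<close> is kept as an abstract nonnegative function; the theorem inserts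
  \<open>rn_density PX QX\<close>.\<close>

lemma split_miscoverage_tail:
  fixes M :: "'w measure" and MX :: "'x measure" and MY :: "'y measure"
    and Z :: "nat \<Rightarrow> 'w \<Rightarrow> 'x \<times> 'y" and T :: "(nat \<Rightarrow> 'x \<times> 'y) \<Rightarrow> 'x \<Rightarrow> 'y"
    and f :: "'y \<Rightarrow> 'y \<Rightarrow> real" and \<alpha> B \<delta> :: real
  assumes mn: "1 \<le> m" "m < n" and M: "prob_space M"
    and ind: "prob_space.indep_vars M (\<lambda>_. MX \<Otimes>\<^sub>M MY) Z {1..n}"
    and dZ: "\<forall>i\<in>{1..n}. distr M (MX \<Otimes>\<^sub>M MY) (Z i) = P"
    and Ztest[measurable]: "Ztest \<in> M \<rightarrow>\<^sub>M MX \<Otimes>\<^sub>M MY" and dZt: "distr M (MX \<Otimes>\<^sub>M MY) Ztest = Q"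
    and ind_test: "prob_space.indep_set M (sets (sample_algebra M (MX \<Otimes>\<^sub>M MY) Z n))
        (sets (vimage_algebra (space M) Ztest (MX \<Otimes>\<^sub>M MY)))"
    and \<alpha>: "0 < \<alpha>" "\<alpha> < 1"
    and T: "(\<lambda>(D, x). T D x) \<in> (\<Pi>\<^sub>M i\<in>{1..n - m}. MX \<Otimes>\<^sub>M MY) \<Otimes>\<^sub>M MX \<rightarrow>\<^sub>M MY"
    and f: "(\<lambda>(y, y'). f y y') \<in> borel_measurable (MY \<Otimes>\<^sub>M MY)"
    and ac: "absolutely_continuous P Q" and RN: "AE z in P. RN_deriv P Q z \<le> ennreal B"
    and \<delta>: "0 < \<delta>" "\<delta> \<le> 4" and rX: "\<And>x. 0 \<le> rX x"
  shows "measure M {\<omega> \<in> space M.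
      split_miscoverage M MX MY (rn_density P Q) rX T f n m \<alpha> Z Ztest \<omega>
        > \<alpha> + (sqrt (2 * B * ln (4 / \<delta>)) + 2 * 2) * sqrt (B / real m)} \<le> \<delta>"
proof (cases "\<delta> < 1")
  \<comment> \<open>Trivial for \<delta> at least 1. This also removes \<delta> = 4, where the
    logarithm and hence \<open>u\<close> vanish, while \<open>threshold_deviation\<close> needs
    \<open>u > 0\<close>.\<close>
  case False
  interpret prob_space M by (rule M)
  show ?thesis using False by (intro order.trans[OF prob_le_1]) simp
next
  case True
  interpret prob_space M by (rule M)
  let ?N = "MX \<Otimes>\<^sub>M MY"
  let ?J = "{1..n - m}" and ?I = "{n - m + 1..n}"
  let ?S = "\<Pi>\<^sub>M i\<in>{1..n}. ?N"
  have Z[measurable]: "Z i \<in> M \<rightarrow>\<^sub>M ?N" if "i \<in> {1..n}" for i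
    using ind that unfolding indep_vars_def by blast
  have "P = distr M ?N (Z 1)" using dZ mn by auto
  then have setsP[measurable_cong]: "sets P = sets ?N" and prP: "prob_space P"
    using mn by (auto intro: prob_space_distr Z)
  have setsQ[measurable_cong]: "sets Q = sets ?N" and prQ: "prob_space Q"
    using dZt by (auto intro: prob_space_distr)
  interpret P: prob_space P by (rule prP)
  interpret Q: prob_space Q by (rule prQ)
  have spP: "space P = space ?N" and spQ: "space Q = space ?N"
    using setsP setsQ by (auto dest: sets_eq_imp_space_eq)

  define r0 where "r0 = rn_density P Q"
  \<comment> \<open>The density is bounded only almost everywhere, whereas
    \<open>bounded_weight\<close> asks for bounds everywhere. \<open>max B 0\<close> keeps the
    truncation nonnegative until \<open>B > 0\<close> is derived from its mean being 1.\<close>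
  define r where "r z = min (r0 z) (max B 0)" for z
  have r0_nonneg: "0 \<le> r0 z" for z by (simp add: r0_def rn_density_def)
  have r0m[measurable]: "r0 \<in> borel_measurable ?N"
    using measurable_cong_sets[OF setsP refl] unfolding r0_def rn_density_def[abs_def] by measurable
  have rm[measurable]: "r \<in> borel_measurable ?N" unfolding r_def by measurable
  have RN_r: "AE z in P. RN_deriv P Q z = ennreal (r z)"
    using RN
  proof eventually_elim
    case (elim z)
    then have "RN_deriv P Q z < \<top>" by (simp add: le_less_trans)
    then have 1: "RN_deriv P Q z = ennreal (r0 z)"
      by (simp add: r0_def rn_density_def)
    with elim have "r0 z \<le> max B 0"
      by (cases "0 \<le> B") (auto simp: ennreal_neg r0_nonneg)
    with 1 show ?case by (simp add: r_def)
  qed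
  have r0_r: "AE z in P. r0 z = r z"
    using RN_r
  proof eventually_elim
    case (elim z)
    moreover have "0 \<le> r z" using r0_nonneg by (simp add: r_def)
    ultimately show ?case by (simp add: r0_def rn_density_def)
  qed
  have r_bounds: "0 \<le> r z \<and> r z \<le> max B 0" for z
    using r0_nonneg[of z] by (auto simp: r_def)
  have Q_eq: "measure Q A = P.expectation (\<lambda>z. r z * indicator A z)" if A[measurable]: "A \<in> sets ?N" for A
  proof -
    have "emeasure Q A = emeasure (density P (RN_deriv P Q)) A"
      using P.density_RN_deriv[OF ac] setsP setsQ by simp
    also have "\<dots> = (\<integral>\<^sup>+z. RN_deriv P Q z * indicator A z \<partial>P)"
      using setsP by (intro emeasure_density) auto
    also have "\<dots> = (\<integral>\<^sup>+z. ennreal (r z * indicator A z) \<partial>P)"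
      using RN_r by (intro nn_integral_cong_AE) (auto elim!: eventually_mono simp: indicator_def)
    finally show ?thesis
      unfolding measure_def using r_bounds
      by (subst integral_eq_nn_integral) auto
  qed
  have exp_r: "P.expectation r = 1"
  proof -
    have "P.expectation r = P.expectation (\<lambda>z. r z * indicator (space ?N) z)"
      using spP by (intro Bochner_Integration.integral_cong) auto
    also have "\<dots> = measure Q (space Q)"
      using Q_eq[of "space ?N"] spQ by simp
    finally show ?thesis by (simp add: Q.prob_space)
  qed
  have B: "B > 0" "max B 0 = B"
  proof -
    have "P.expectation r = 0" if "B \<le> 0"
      using that r_bounds by (intro integral_eq_zero_AE AE_I2) (simp add: order_antisym max_def)
    then show "B > 0" using exp_r by fastforce
    then show "max B 0 = B" by simp
  qed

  define s where "s d = score f (T (restrict d ?J))" for d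
  have sm[measurable]: "(\<lambda>(d, z). s d z) \<in> borel_measurable (?S \<Otimes>\<^sub>M ?N)"
  proof -
    have "(\<lambda>d. restrict d ?J) \<in> ?S \<rightarrow>\<^sub>M (\<Pi>\<^sub>M i\<in>?J. ?N)"
      by (rule measurable_restrict_subset) auto
    from measurable_Pair[OF measurable_compose[OF measurable_fst this] measurable_compose[OF measurable_snd measurable_fst]]
    have "(\<lambda>p. (restrict (fst p) ?J, fst (snd p))) \<in> ?S \<Otimes>\<^sub>M ?N \<rightarrow>\<^sub>M (\<Pi>\<^sub>M i\<in>?J. ?N) \<Otimes>\<^sub>M MX"
      .
    from measurable_Pair[OF measurable_compose[OF this T] measurable_compose[OF measurable_snd measurable_snd]]
    have "(\<lambda>p. (T (restrict (fst p) ?J) (fst (snd p)), snd (snd p))) \<in> ?S \<Otimes>\<^sub>M ?N \<rightarrow>\<^sub>M MY \<Otimes>\<^sub>M MY"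
      by simp
    from measurable_compose[OF this f] show ?thesis
      by (simp add: s_def score_def case_prod_beta')
  qed
  define A where "A = {(d, z) \<in> space (?S \<Otimes>\<^sub>M ?N). \<exists>t\<in>\<rat>.
    (1 - \<alpha>) * (\<Sum>i\<in>?I. r (d i)) \<le> (\<Sum>i\<in>?I. r (d i) * of_bool (s d (d i) \<le> t)) \<and> t < s d z}"
  have A[measurable]: "A \<in> sets (?S \<Otimes>\<^sub>M ?N)"
  proof -
    have comp: "(\<lambda>p. fst p i) \<in> ?S \<Otimes>\<^sub>M ?N \<rightarrow>\<^sub>M ?N" if "i \<in> ?I" for i
      using that by (intro measurable_compose[OF measurable_fst measurable_component_singleton]) auto
    have ri: "(\<lambda>p. r (fst p i)) \<in> borel_measurable (?S \<Otimes>\<^sub>M ?N)" if "i \<in> ?I" for i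
      using measurable_compose[OF comp[OF that] rm] .
    have si: "(\<lambda>p. s (fst p) (fst p i)) \<in> borel_measurable (?S \<Otimes>\<^sub>M ?N)" if "i \<in> ?I" for i
      using measurable_compose[OF measurable_Pair[OF measurable_fst comp[OF that]] sm] by simp
    have 1: "(\<lambda>p. \<Sum>i\<in>?I. r (fst p i)) \<in> borel_measurable (?S \<Otimes>\<^sub>M ?N)"
      by (intro borel_measurable_sum ri)
    have 2: "(\<lambda>p. \<Sum>i\<in>?I. r (fst p i) * of_bool (s (fst p) (fst p i) \<le> t))
        \<in> borel_measurable (?S \<Otimes>\<^sub>M ?N)" for t
    proof (intro borel_measurable_sum)
      fix i assume i: "i \<in> ?I"
      note [measurable] = ri[OF i] si[OF i]
      show "(\<lambda>p. r (fst p i) * of_bool (s (fst p) (fst p i) \<le> t)) \<in> borel_measurable (?S \<Otimes>\<^sub>M ?N)"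
        unfolding of_bool_def by measurable
    qed
    have 3: "(\<lambda>p. s (fst p) (snd p)) \<in> borel_measurable (?S \<Otimes>\<^sub>M ?N)"
      using sm by (simp add: case_prod_beta')
    have "Measurable.pred (?S \<Otimes>\<^sub>M ?N) (\<lambda>p. \<exists>t\<in>\<rat>.
        (1 - \<alpha>) * (\<Sum>i\<in>?I. r (fst p i)) \<le> (\<Sum>i\<in>?I. r (fst p i) * of_bool (s (fst p) (fst p i) \<le> t))
          \<and> t < s (fst p) (snd p))"
      by (intro pred_bex_Rats pred_intros_logic borel_measurable_le[OF borel_measurable_times 2, folded pred_def]
          borel_measurable_less[OF borel_measurable_const 3, folded pred_def] 1 borel_measurable_const)
    then show ?thesis
      unfolding A_def by (simp add: pred_def case_prod_beta')
  qed
  define H where "H d = measure Q (Pair d -` A)" for d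
  have Hm[measurable]: "H \<in> borel_measurable ?S"
  proof -
    have [measurable]: "(\<lambda>d. emeasure Q (Pair d -` A)) \<in> borel_measurable ?S"
      using A by (intro Q.measurable_emeasure_Pair) (simp add: sets_pair_measure_cong[OF refl setsQ])
    show ?thesis unfolding H_def measure_def by measurable
  qed
  define thr where "thr = \<alpha> + (sqrt (2 * B * ln (4 / \<delta>)) + 2 * 2) * sqrt (B / real m)"

  have sample[measurable]: "sample Z n \<in> M \<rightarrow>\<^sub>M ?S"
    unfolding sample_def[abs_def] by (intro measurable_restrict Z)
  have dsample: "distr M ?S (sample Z n) = (\<Pi>\<^sub>M i\<in>{1..n}. P)"
  proof -
    have "{1..n} \<noteq> {}" using mn by simp
    then have "distr M ?S (\<lambda>x. \<lambda>i\<in>{1..n}. Z i x) = (\<Pi>\<^sub>M i\<in>{1..n}. distr M ?N (Z i))"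
      using indep_vars_iff_distr_eq_PiM'[of "{1..n}" Z "\<lambda>_. ?N"] ind Z by simp
    also have "\<dots> = (\<Pi>\<^sub>M i\<in>{1..n}. P)"
      using dZ by (intro PiM_cong) auto
    finally show ?thesis by (simp add: sample_def[abs_def])
  qed
  define E where "E = {\<omega> \<in> space M.
    snd (Ztest \<omega>) \<notin> split_conformal_set MY r0 rX T f n m \<alpha> (sample Z n \<omega>) (fst (Ztest \<omega>))}"
  have cond: "AE \<omega> in M. split_miscoverage M MX MY r0 rX T f n m \<alpha> Z Ztest \<omega> \<le> H (sample Z n \<omega>)"
  proof -
    let ?F = "sample_algebra M ?N Z n"
    let ?E' = "{\<omega> \<in> space M. (sample Z n \<omega>, Ztest \<omega>) \<in> A}"
    have sub: "subalgebra M ?F"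
      using sets_image_in_sets[OF refl sample] by (simp add: subalgebra_def sample_algebra_def)
    interpret F: finite_measure_subalgebra M ?F
      by unfold_locales (rule sub)
    have E': "AE \<omega> in M. real_cond_exp M ?F (indicator ?E') \<omega> = H (sample Z n \<omega>)"
      using real_cond_exp_indep_pair[OF sample Ztest ind_test[unfolded sample_algebra_def] A] by (simp add: sample_algebra_def H_def dZt)
    \<comment> \<open>The prediction set uses \<open>r0\<close> and \<open>A\<close> uses
      \<open>r\<close>. They agree at all sample points almost surely, because each
      \<open>Z i\<close> has law \<open>P\<close>.\<close>
    have "AE \<omega> in M. r0 (Z i \<omega>) = r (Z i \<omega>)" if i: "i \<in> {1..n}" for i
    proof (rule AE_distrD[OF Z[OF i]])
      show "AE z in distr M ?N (Z i). r0 z = r z" using r0_r unfolding dZ[rule_format, OF i] .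
    qed
    then have "AE \<omega> in M. \<forall>i\<in>{1..n}. r0 (Z i \<omega>) = r (Z i \<omega>)"
      by (intro AE_finite_allI) auto
    then have sub: "AE \<omega> in M. indicator E \<omega> \<le> (indicator ?E' \<omega> :: real)"
    proof (rule AE_mp, intro AE_I2 impI)
      fix \<omega> assume \<omega>: "\<omega> \<in> space M" and eq: "\<forall>i\<in>{1..n}. r0 (Z i \<omega>) = r (Z i \<omega>)"
      let ?d = "sample Z n \<omega>"
      have "?d i = Z i \<omega>" if "i \<in> ?I" for i
        using that by (simp add: sample_def)
      then have r0r: "r0 (?d i) = r (?d i)" if "i \<in> ?I" for i
        using that eq by simp
      have "\<omega> \<in> ?E'" if "\<omega> \<in> E"
      proof -
        have zt: "Ztest \<omega> \<in> space ?N" and d: "?d \<in> space ?S"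
          using measurable_space[OF Ztest \<omega>] measurable_space[OF sample \<omega>] by auto
        have "\<exists>t\<in>\<rat>. (1 - \<alpha>) * (\<Sum>i\<in>?I. r0 (?d i)) \<le> (\<Sum>i\<in>?I. r0 (?d i) * of_bool (s ?d (?d i) \<le> t))
            \<and> t < s ?d (Ztest \<omega>)"
          unfolding s_def
        proof (rule miscoverage_imp_threshold[OF r0_nonneg rX \<alpha>(2)])
          show "snd (Ztest \<omega>) \<in> space MY" using zt by (auto simp: space_pair_measure)
          show "snd (Ztest \<omega>) \<notin> split_conformal_set MY r0 rX T f n m \<alpha> ?d (fst (Ztest \<omega>))"
            using that by (simp add: E_def)
        qed
        moreover have "(\<Sum>i\<in>?I. r0 (?d i)) = (\<Sum>i\<in>?I. r (?d i))"
          "\<And>t. (\<Sum>i\<in>?I. r0 (?d i) * of_bool (s ?d (?d i) \<le> t)) = (\<Sum>i\<in>?I. r (?d i) * of_bool (s ?d (?d i) \<le> t))"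
          by (intro sum.cong refl; simp add: r0r)+
        ultimately show ?thesis
          using \<omega> zt d by (simp only: A_def mem_Collect_eq prod.case space_pair_measure mem_Sigma_iff simp_thms)
      qed
      then show "indicator E \<omega> \<le> (indicator ?E' \<omega> :: real)"
        by (auto simp: indicator_def)
    qed
    have mis: "split_miscoverage M MX MY r0 rX T f n m \<alpha> Z Ztest = real_cond_exp M ?F (indicator E)"
      by (simp add: split_miscoverage_def E_def)
    show ?thesis
    proof (cases "E \<in> sets M")
      case True
      have "AE \<omega> in M. real_cond_exp M ?F (indicator E) \<omega> \<le> real_cond_exp M ?F (indicator ?E') \<omega>"
        using True by (intro F.real_cond_exp_mono sub integrable_const_bound[of _ 1]) auto
      with E' show ?thesis unfolding mis by eventually_elim simp
    next
      case False
      \<comment> \<open>The conditional expectation of a non-measurable function is a junk value, here at most 0.\<close>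
      have "(\<lambda>\<omega>. ennreal (indicator E \<omega>)) \<notin> borel_measurable M"
      proof
        assume "(\<lambda>\<omega>. ennreal (indicator E \<omega>)) \<in> borel_measurable M"
        then have "(\<lambda>\<omega>. ennreal (indicator E \<omega>)) -` {1} \<inter> space M \<in> sets M"
          by (rule measurable_sets) simp
        also have "(\<lambda>\<omega>. ennreal (indicator E \<omega>)) -` {1} \<inter> space M = E"
          by (auto simp: E_def indicator_def)
        finally show False using False by simp
      qed
      then have "real_cond_exp M ?F (indicator E) \<omega> \<le> 0" for \<omega>
        by (simp add: real_cond_exp_def nn_cond_exp_def)
      moreover have "0 \<le> H (sample Z n \<omega>)" for \<omega>
        by (simp add: H_def)
      ultimately show ?thesis
        unfolding mis by (intro AE_I2) (rule order.trans)
    qed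
  qed
  have tail: "measure (\<Pi>\<^sub>M i\<in>{1..n}. P) {d \<in> space ?S. thr < H d} \<le> \<delta>"
  proof -
    interpret PP: product_prob_space "\<lambda>_::nat. P" by unfold_locales
    interpret PJ: prob_space "\<Pi>\<^sub>M i\<in>?J. P" by (rule P.prob_space_PiM_const)
    interpret PN: prob_space "\<Pi>\<^sub>M i\<in>{1..n}. P" by (rule P.prob_space_PiM_const)
    have setsS: "sets (\<Pi>\<^sub>M i\<in>L. P) = sets (\<Pi>\<^sub>M i\<in>L. ?N)" for L :: "nat set"
      using setsP by (intro sets_PiM_cong) auto
    have spS: "space (\<Pi>\<^sub>M i\<in>L. P) = space (\<Pi>\<^sub>M i\<in>L. ?N)" for L :: "nat set"
      using setsS by (rule sets_eq_imp_space_eq)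
    have JI: "?J \<union> ?I = {1..n}" "?J \<inter> ?I = {}" "card ?I = m" "?I \<noteq> {}"
      using mn by auto
    define L where "L = ln (4 / \<delta>)"
    have L: "L > 0" using True \<delta> by (simp add: L_def)
    \<comment> \<open>\<open>m\<close> times the deviation term of the claim, because
      \<open>sup_deviation\<close> is a sum.\<close>
    define u where "u = real m * (sqrt (2 * B * L) * sqrt (B / real m))"
    have m0: "real m > 0" using mn by simp
    have u: "u > 0" using m0 L B by (simp add: u_def)
    have "u\<^sup>2 = (real m)\<^sup>2 * (2 * B * L * (B / real m))"
      using m0 L B by (simp add: u_def power_mult_distrib)
    then have "u\<^sup>2 = 2 * real m * B\<^sup>2 * L"
      using m0 by (simp add: power2_eq_square)
    then have expo: "- 2 * u\<^sup>2 / (real m * B\<^sup>2) = - 4 * L"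
      using m0 B by simp
    \<comment> \<open>McDiarmid yields \<open>(\<delta> / 4) ^ 4\<close>, which is more than
      enough.\<close>
    have "exp (- 4 * L) \<le> exp (- L)" using L by simp
    also have "\<dots> = \<delta> / 4" using \<delta> by (simp add: L_def exp_minus)
    finally have exp4: "exp (- 4 * L) \<le> \<delta>" using \<delta> by simp
    have thr: "thr = \<alpha> + (4 * sqrt (real m * B) + u) / real m"
    proof -
      have "sqrt (real m * B) = real m * sqrt (B / real m)"
        using m0 B by (simp add: real_sqrt_mult real_sqrt_divide field_simps)
      then show ?thesis
        using m0 by (simp add: thr_def u_def L_def field_simps)
    qed
    have thr0: "0 \<le> thr" using \<alpha> m0 u B unfolding thr by simp
    let ?X = "{d \<in> space ?S. thr < H d}"
    have X: "?X \<in> sets (\<Pi>\<^sub>M i\<in>?J \<union> ?I. P)"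
      unfolding setsS JI(1) by measurable
    \<comment> \<open>Once the training points \<open>d1\<close> are fixed, the score is a fixed
      function, and the calibration points are still i.i.d. from \<open>P\<close>.\<close>
    have "emeasure (\<Pi>\<^sub>M i\<in>{1..n}. P) ?X
        = (\<integral>\<^sup>+d1. emeasure (\<Pi>\<^sub>M i\<in>?I. P) ((\<lambda>x. merge ?J ?I (d1, x)) -` ?X \<inter> space (\<Pi>\<^sub>M i\<in>?I. P)) \<partial>(\<Pi>\<^sub>M i\<in>?J. P))"
      using PP.emeasure_fold_integral[OF JI(2) _ _ X] by (simp only: JI(1) finite_atLeastAtMost)
    also have "\<dots> \<le> (\<integral>\<^sup>+d1. ennreal \<delta> \<partial>(\<Pi>\<^sub>M i\<in>?J. P))"
    proof (intro nn_integral_mono)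
      fix d1 assume d1: "d1 \<in> space (\<Pi>\<^sub>M i\<in>?J. P)"
      let ?s = "score f (T d1)"
      have rs: "restrict d1 ?J = d1"
        using d1 by (simp add: space_PiM PiE_def extensional_restrict)
      have s_eq: "s (merge ?J ?I (d1, x)) = ?s" for x
        by (simp add: s_def rs[simplified])
      have sm1: "?s \<in> borel_measurable P"
      proof -
        have "(\<lambda>z. T d1 (fst z)) \<in> ?N \<rightarrow>\<^sub>M MY"
          using measurable_compose[OF measurable_Pair[OF measurable_const[of d1] measurable_fst] T] d1
          by (simp add: spS)
        from measurable_compose[OF measurable_Pair[OF this measurable_snd] f]
        show ?thesis
          unfolding measurable_cong_sets[OF setsP refl] by (simp add: score_def[abs_def])
      qed
      interpret W: bounded_weight P r ?s \<alpha> B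
      proof
        show "r \<in> borel_measurable P" by measurable
      qed (use sm1 r_bounds B exp_r \<alpha> in auto)
      have "emeasure (\<Pi>\<^sub>M i\<in>?I. P) ((\<lambda>x. merge ?J ?I (d1, x)) -` ?X \<inter> space (\<Pi>\<^sub>M i\<in>?I. P))
        \<le> emeasure (\<Pi>\<^sub>M i\<in>?I. P) {x \<in> space (\<Pi>\<^sub>M i\<in>?I. P). \<exists>t\<in>\<rat>.
            (1 - \<alpha>) * (\<Sum>i\<in>?I. r (x i)) \<le> (\<Sum>i\<in>?I. r (x i) * of_bool (?s (x i) \<le> t))
            \<and> P.expectation (\<lambda>z. r z * of_bool (t < ?s z)) > \<alpha> + (4 * sqrt (real (card ?I) * B) + u) / real (card ?I)}"
      proof (intro emeasure_mono subsetI)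
        fix x assume "x \<in> (\<lambda>x. merge ?J ?I (d1, x)) -` ?X \<inter> space (\<Pi>\<^sub>M i\<in>?I. P)"
        then have x: "x \<in> space (\<Pi>\<^sub>M i\<in>?I. P)" and dS: "merge ?J ?I (d1, x) \<in> space ?S"
          and Hx: "thr < H (merge ?J ?I (d1, x))" by auto
        have mi: "merge ?J ?I (d1, x) i = x i" if "i \<in> ?I" for i
          using that by (simp add: merge_def)
        \<comment> \<open>The rational thresholds accepted by calibration. \<open>H\<close> becomes
          the \<open>Q\<close>-mass of scores above some member of \<open>G\<close>; if it exceeds
          \<open>thr\<close>, a single member already does.\<close>
        define G where "G = {t \<in> \<rat>. (1 - \<alpha>) * (\<Sum>i\<in>?I. r (x i)) \<le> (\<Sum>i\<in>?I. r (x i) * of_bool (?s (x i) \<le> t))}"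
        have G: "countable G" unfolding G_def by (rule countable_subset[OF _ countable_rat]) auto
        define e where "e = merge ?J ?I (d1, x)"
        have "(\<Sum>i\<in>?I. r (e i)) = (\<Sum>i\<in>?I. r (x i))"
          "\<And>t. (\<Sum>i\<in>?I. r (e i) * of_bool (s e (e i) \<le> t)) = (\<Sum>i\<in>?I. r (x i) * of_bool (?s (x i) \<le> t))"
          unfolding e_def s_eq by (intro sum.cong refl; simp only: mi)+
        moreover have "e \<in> space ?S" "s e = ?s" using dS s_eq by (simp_all only: e_def)
        ultimately have "(e, z) \<in> A \<longleftrightarrow> z \<in> {z \<in> space Q. \<exists>t\<in>G. t < ?s z}" for z
          unfolding A_def G_def spQ
          by (simp only: mem_Collect_eq prod.case space_pair_measure mem_Sigma_iff) blast
        then have "Pair (merge ?J ?I (d1, x)) -` A = {z \<in> space Q. \<exists>t\<in>G. t < ?s z}"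
          unfolding e_def[symmetric] by blast
        then have HG: "H (merge ?J ?I (d1, x)) = measure Q {z \<in> space Q. \<exists>t\<in>G. t < ?s z}"
          by (simp add: H_def)
        have sQ: "?s \<in> borel_measurable Q"
          using sm1 setsP setsQ by (simp cong: measurable_cong_sets)
        have "\<exists>t\<in>G. thr < measure Q {z \<in> space Q. t < ?s z}"
          using Q.measure_Union_thresholds_le[OF sQ G thr0] Hx unfolding HG by fastforce
        then obtain t where t: "t \<in> G" "thr < measure Q {z \<in> space Q. t < ?s z}" by auto
        have "{z \<in> space Q. t < ?s z} \<in> sets ?N"
          unfolding setsQ[symmetric] using borel_measurable_less[OF borel_measurable_const sQ] .
        then have "measure Q {z \<in> space Q. t < ?s z}
            = P.expectation (\<lambda>z. r z * indicator {z \<in> space Q. t < ?s z} z)"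
          by (rule Q_eq)
        also have "\<dots> = P.expectation (\<lambda>z. r z * of_bool (t < ?s z))"
          by (intro Bochner_Integration.integral_cong) (auto simp: spP spQ indicator_def)
        finally show "x \<in> {x \<in> space (\<Pi>\<^sub>M i\<in>?I. P). \<exists>t\<in>\<rat>.
            (1 - \<alpha>) * (\<Sum>i\<in>?I. r (x i)) \<le> (\<Sum>i\<in>?I. r (x i) * of_bool (?s (x i) \<le> t))
            \<and> P.expectation (\<lambda>z. r z * of_bool (t < ?s z)) > \<alpha> + (4 * sqrt (real (card ?I) * B) + u) / real (card ?I)}"
          using t x unfolding JI(3) thr[symmetric] G_def by auto
      qed (rule W.sets_threshold_deviation)
      also have "\<dots> \<le> ennreal (exp (- 2 * u\<^sup>2 / (real (card ?I) * B\<^sup>2)))"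
        using JI(4) u by (intro W.threshold_deviation) auto
      also have "\<dots> \<le> ennreal \<delta>"
        unfolding JI(3) expo using exp4 by (rule ennreal_leI)
      finally show "emeasure (\<Pi>\<^sub>M i\<in>?I. P) ((\<lambda>x. merge ?J ?I (d1, x)) -` ?X \<inter> space (\<Pi>\<^sub>M i\<in>?I. P)) \<le> ennreal \<delta>" .
    qed
    also have "\<dots> = ennreal \<delta>" using PJ.emeasure_space_1 by simp
    finally show ?thesis
      using \<delta> unfolding PN.emeasure_eq_measure by simp
  qed
  have "measure M {\<omega> \<in> space M. split_miscoverage M MX MY r0 rX T f n m \<alpha> Z Ztest \<omega> > thr}
      \<le> measure M {\<omega> \<in> space M. thr < H (sample Z n \<omega>)}"
    using cond by (intro finite_measure_mono_AE) (auto elim!: eventually_mono)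
  also have "\<dots> = measure (distr M ?S (sample Z n)) {d \<in> space ?S. thr < H d}"
  proof -
    have X: "{d \<in> space ?S. thr < H d} \<in> sets ?S" by measurable
    have "{\<omega> \<in> space M. thr < H (sample Z n \<omega>)} = sample Z n -` {d \<in> space ?S. thr < H d} \<inter> space M"
      using measurable_space[OF sample] by blast
    then show ?thesis unfolding measure_distr[OF sample X] by (simp only:)
  qed
  also have "\<dots> \<le> \<delta>"
    unfolding dsample by (rule tail)
  finally show ?thesis
    by (simp add: thr_def r0_def)
qed

theorem theorem1:
  shows "\<exists>C::real. 0 < C \<and> C \<le> 100 \<and>
    (\<forall>(M :: 'w measure) (MX :: 'x measure) (MY :: 'y measure) PX QX K P Q
      (n::nat) (m::nat) (Z :: nat \<Rightarrow> 'w \<Rightarrow> 'x \<times> 'y) Ztest T f (\<alpha>::real) (B::real).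
      PX \<in> space (prob_algebra MX) \<longrightarrow>
      QX \<in> space (prob_algebra MX) \<longrightarrow>
      K \<in> MX \<rightarrow>\<^sub>M prob_algebra MY \<longrightarrow>
      P = joint_law MX MY PX K \<longrightarrow>
      Q = joint_law MX MY QX K \<longrightarrow>
      1 \<le> m \<longrightarrow> m < n \<longrightarrow>
      prob_space M \<longrightarrow>
      prob_space.indep_vars M (\<lambda>_. MX \<Otimes>\<^sub>M MY) Z {1..n} \<longrightarrow>
      (\<forall>i\<in>{1..n}. distr M (MX \<Otimes>\<^sub>M MY) (Z i) = P) \<longrightarrow>
      Ztest \<in> M \<rightarrow>\<^sub>M MX \<Otimes>\<^sub>M MY \<longrightarrow>
      distr M (MX \<Otimes>\<^sub>M MY) Ztest = Q \<longrightarrow>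
      prob_space.indep_set M (sets (sample_algebra M (MX \<Otimes>\<^sub>M MY) Z n))
        (sets (vimage_algebra (space M) Ztest (MX \<Otimes>\<^sub>M MY))) \<longrightarrow>
      0 < \<alpha> \<longrightarrow> \<alpha> < 1 \<longrightarrow>
      (\<lambda>(D, x). T D x) \<in> (\<Pi>\<^sub>M i\<in>{1..n - m}. MX \<Otimes>\<^sub>M MY) \<Otimes>\<^sub>M MX \<rightarrow>\<^sub>M MY \<longrightarrow>
      (\<lambda>(y, y'). f y y') \<in> borel_measurable (MY \<Otimes>\<^sub>M MY) \<longrightarrow>
      absolutely_continuous P Q \<longrightarrow>
      (AE z in P. RN_deriv P Q z \<le> ennreal B) \<longrightarrow>
      (\<forall>\<delta>::real. 0 < \<delta> \<longrightarrow> \<delta> \<le> 4 \<longrightarrow>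
        measure M {\<omega> \<in> space M.
          split_miscoverage M MX MY (rn_density P Q) (rn_density PX QX) T f n m \<alpha> Z Ztest \<omega>
            > \<alpha> + (sqrt (2 * B * ln (4 / \<delta>)) + 2 * C) * sqrt (B / real m)}
        \<le> \<delta>))"
proof (intro exI[of _ "2::real"] conjI allI impI)
  \<comment> \<open>The witness is 2 because \<open>2 * C\<close> has to be the factor 4 of
    \<open>integral_sup_deviation_le\<close>.\<close>
  show "(0::real) < 2" "(2::real) \<le> 100" by simp_all
qed (rule split_miscoverage_tail, assumption+, simp add: rn_density_def)

end
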